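(* Let $q\in\mathbb{C}$ be a fixed constant with $|q|\ne1$. Let $T_{a_1,\lambda_1},T_{a_2,\lambda_1},T_{\kappa_1,\lambda_1},T_{\kappa_1,\lambda_2}$ be the connection preserving deformations acting on $(\kappa_1,\kappa_2,\lambda_1,\lambda_2,a_1,a_2;w,y,z)$, and let $T_0,T_1,T_2,T_3$ be the translations of type $(A_2+A_1)^{(1)}$ acting on $(b_0,b_1,b_2;f_0,f_1,f_2)$, where $b_0b_1b_2=\sqrt q$ and $f_0f_1f_2=qc^2$, all as defined in the context. The following changes of variables give correspondences between evolutions. (I) The evolution of $T_{a_1,\lambda_1}^{-1}$ corresponds to that of $T_0$ by letting $$y=-\frac{a_1}{b_0f_0},\quad z=-\frac{f_1}{b_1},\quad b_0^2=\frac{a_1}{a_2},\quad b_1^2=-\frac{a_2\kappa_2}{\lambda_1},\quad c^2=\frac{a_1a_2\kappa_1}{\sqrt q\,\lambda_1}.$$ (II) The evolution of $T_{\kappa_1,\lambda_1}$ corresponds to that of $T_0$ by letting $$y=-\frac{a_1b_0b_1f_0f_1}{c^2q^{3/2}},\quad z=-\frac{f_0}{b_0},\quad b_0^2=-\frac{a_2\kappa_2}{\lambda_1},\quad b_1^2=-\frac{q\lambda_1}{a_1\kappa_2},\quad c^2=\frac{a_1a_2\kappa_1}{\sqrt q\,\lambda_1}.$$ (III) The evolution of $T_{a_2,\lambda_1}^{-1}$ corresponds to that of $T_0$ by letting $$y=-\frac{a_2b_1}{f_1},\quad z=\frac{qa_1\kappa_1}{b_0b_1f_0f_1\kappa_2},\quad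 b_0^2=-\frac{q\lambda_1}{a_1\kappa_2},\quad b_1^2=\frac{a_1}{a_2},\quad c^2=\frac{a_1a_2\kappa_1}{\sqrt q\,\lambda_1}.$$ (I$'$) A second correspondence between $T_{a_1,\lambda_1}^{-1}$ and $T_0$, which inverts the value of $c$, is given by $$y=-a_2b_0f_0,\quad z=-\frac1{b_1f_1},\quad b_0^2=\frac{a_1}{a_2},\quad b_1^2=-\frac{a_2\kappa_2}{\lambda_1},\quad c^2=\frac{\lambda_1}{q\sqrt q\,a_1a_2\kappa_1}.$$ There are similar correspondences inverting $c$ for $T_{\kappa_1,\lambda_1}$ and for $T_{a_2,\lambda_1}^{-1}$. Altogether, the lattice of connection preserving deformations aligns with the root lattice in six ways. In the first three, which fix $c$, $(T_0,T_1,T_2,T_3)$ corresponds to $$(T_{a_1,\lambda_1}^{-1},T_{\kappa_1,\lambda_1},T_{a_2,\lambda_1}^{-1},T_{\kappa_1,\lambda_2}),\quad (T_{\kappa_1,\lambda_1},T_{a_2,\lambda_1}^{-1},T_{a_1,\lambda_1}^{-1},T_{\kappa_1,\lambda_2}),\quad (T_{a_2,\lambda_1}^{-1},T_{a_1,\lambda_1}^{-1},T_{\kappa_1,\lambda_1},T_{\kappa_1,\lambda_2}).$$ The last three, which invert $c$, are the same three with $T_{\kappa_1,\lambda_2}$ replaced by $T_{\kappa_1,\lambda_2}^{-1}$. Moreover, the element that changes correspondences between (I) and (II) is $\sigma_0$: if $(b_i;f_i)$ are the variables of (II) and $(\tilde b_i;\tilde f_i)$ those of (I), then $\tilde b_0^2=b_2^2$,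 $\tilde b_1^2=b_0^2$, $\tilde c^2=c^2$, $\tilde f_0=f_2$, $\tilde f_1=f_0$. The element that changes correspondences between (I) and (I$'$) is $\sigma_1$: $\tilde b_i=b_i$, $q\tilde c^2=1/(qc^2)$, $\tilde f_0=1/f_0$, $\tilde f_1=1/f_1$.
   Context: **Connection preserving deformations.** The variables satisfy $\kappa_1\kappa_2a_1a_2=\lambda_1\lambda_2$. Tildes denote images; variables not mentioned are unchanged. - $T_{a_1,\lambda_1}$: $a_1\to qa_1$, $\lambda_1\to q\lambda_1$, with $\tilde w=w(1-\tilde z)$, $\tilde yy=\frac{\tilde z(\tilde za_2\kappa_2+q\lambda_1)}{q(\tilde z-1)\kappa_1}$, $\tilde zz=\frac{qy(y-a_1)\kappa_1}{(y-a_2)\kappa_2}$. - $T_{a_2,\lambda_1}$: $a_2\to qa_2$, $\lambda_1\to q\lambda_1$, obtained from $T_{a_1,\lambda_1}$ by conjugation with the symmetry $S_{a_1,a_2}$: $a_1\leftrightarrow a_2$, $z\to z\frac{y-a_2}{y-a_1}$ (with $w,y,\kappa_i,\lambda_i$ fixed). - $T_{\kappa_1,\lambda_1}$: $\kappa_1\to q\kappa_1$, $\lambda_1\to q\lambda_1$, with $\tilde w=\frac{w(\tilde z-1)(qy\kappa_1-z\kappa_2)}{z\kappa_1}$, $\tilde yy=\frac{z(\tilde za_2\kappa_2+q\lambda_1)}{q(\tilde z-1)\kappa_1}$, $\tilde z=\frac{qya_1\kappa_1+qz\lambda_1}{qy^2\kappa_1-yz\kappa_2}$. - $T_{\kappa_1,\lambda_2}$: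 $\kappa_1\to q\kappa_1$, $\lambda_2\to q\lambda_2$, with $\tilde w=-w(\tilde z-1)$, $y\tilde y=\frac{\tilde z(\tilde za_2\kappa_2+q\lambda_1)}{q(\tilde z-1)\kappa_1}$, $\tilde zz=-\frac{q\kappa_1(za_1a_2\kappa_2+(a_1-y)\lambda_1)}{\kappa_2(a_2(\kappa_2-qy\kappa_1)+\lambda_1)}$. **The translations of type $(A_2+A_1)^{(1)}$.** - $T_0$: $(b_0,b_1,b_2)\to(\sqrt q\,b_0,\,b_1/\sqrt q,\,b_2)$, with $\tilde f_0f_0=\frac{qc^2(b_1+f_1)}{f_1(b_1f_1+1)}$, $\tilde f_1f_1=\frac{qc^2(b_0\tilde f_0+\sqrt q)}{\tilde f_0(b_0+\sqrt q f_0)}$, and $\tilde f_2$ defined by $\tilde f_0\tilde f_1\tilde f_2=qc^2$. - $\sigma_0:(b_1,b_2,b_0;f_1,f_2,f_0)\to(b_0,b_1,b_2;f_0,f_1,f_2)$, i.e. $(b_0,b_1,b_2;f_0,f_1,f_2)\to(b_2,b_0,b_1;f_2,f_0,f_1)$. The map $\sigma_1$ fixes the $b_i$ and sends $f_i\to1/f_i$. These are the Dynkin diagram automorphisms. - $w_0$ fixes the $b_i$ and sends $f_0\to\frac{b_0b_1(b_2b_0+b_2f_0+f_2f_0)}{f_2(b_0b_1+b_0f_1+f_0f_1)}$, $f_1\to\frac{b_1b_2(b_0b_1+b_0f_1+f_0f_1)}{f_0(b_1b_2+b_1f_2+f_1f_2)}$, $f_2\to\frac{b_2b_0(b_1b_2+b_1f_2+f_1f_2)}{f_1(b_2b_0+b_2f_0+f_2f_0)}$.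 - $T_1=\sigma_0\circ T_0\circ\sigma_0^2$, $T_2=\sigma_0^2\circ T_0\circ\sigma_0$, $T_3=\sigma_1\circ w_0$. They satisfy $T_0\circ T_1\circ T_2=I$, and $T_3$ maps $c\to\sqrt q\,c$.
   Formalization: Misprints corrected: T_0 sends (b_0,b_1) to (b_0/√q, √q b_1) with denominator b_0+√q f̃_0; T_{κ1,λ2} uses z̃(z a_2κ_2+λ_1) and zκ_2−qyκ_1; T_3 applies σ_1 first, then w_0; q≠0; f̃_0=f_2, f̃_1=f_0 (and the σ_1 forms) hold for matching roots b_i. *)

theory Defs
  imports Complex_Main
begin

text \<open>
  All maps of this theory are birational. Each is represented by the graph of the induced partial
  map: an input and an output are related iff both lie in the torus of admissible points (no
  coordinate vanishes, the multiplicative constraints hold), the printed denominators do not vanish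
  and the printed equations hold. Inverses are converses (\<open>conversep\<close>). Composition of
  graphs is \<open>OO\<close>, where \<open>R OO S\<close> applies \<open>R\<close> first, so that the map
  \<open>f \<circ> g\<close> has the graph \<open>G OO F\<close>.

  The parameter \<open>sq\<close> is a square root of \<open>q\<close>, and \<open>q * sq\<close> stands for
  the power \<open>q\<close> to the 3/2.
\<close>

section \<open>Connection preserving deformations\<close>

datatype conn =
  Conn complex complex complex complex complex complex complex complex complex

fun admissible_conn :: "conn \<Rightarrow> bool" where
  "admissible_conn (Conn k1 k2 l1 l2 a1 a2 w y z) \<longleftrightarrow>
     k1 \<noteq> 0 \<and> k2 \<noteq> 0 \<and> l1 \<noteq> 0 \<and> l2 \<noteq> 0 \<and> a1 \<noteq> 0 \<and> a2 \<noteq> 0 \<and> w \<noteq> 0 \<and> y \<noteq> 0 \<and> z \<noteq> 0 \<and>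
     k1 * k2 * a1 * a2 = l1 * l2"

fun T_a1_l1 :: "complex \<Rightarrow> conn \<Rightarrow> conn \<Rightarrow> bool" where
  "T_a1_l1 q (Conn k1 k2 l1 l2 a1 a2 w y z) (Conn k1' k2' l1' l2' a1' a2' w' y' z') \<longleftrightarrow>
     admissible_conn (Conn k1 k2 l1 l2 a1 a2 w y z) \<and>
     admissible_conn (Conn k1' k2' l1' l2' a1' a2' w' y' z') \<and>
     k1' = k1 \<and> k2' = k2 \<and> l1' = q * l1 \<and> l2' = l2 \<and> a1' = q * a1 \<and> a2' = a2 \<and>
     y \<noteq> a2 \<and> z' \<noteq> 1 \<and>
     w' = w * (1 - z') \<and>
     y' * y = z' * (z' * a2 * k2 + q * l1) / (q * (z' - 1) * k1) \<and>
     z' * z = q * y * (y - a1) * k1 / ((y - a2) * k2)"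

fun S_a1_a2 :: "conn \<Rightarrow> conn \<Rightarrow> bool" where
  "S_a1_a2 (Conn k1 k2 l1 l2 a1 a2 w y z) (Conn k1' k2' l1' l2' a1' a2' w' y' z') \<longleftrightarrow>
     admissible_conn (Conn k1 k2 l1 l2 a1 a2 w y z) \<and>
     admissible_conn (Conn k1' k2' l1' l2' a1' a2' w' y' z') \<and>
     k1' = k1 \<and> k2' = k2 \<and> l1' = l1 \<and> l2' = l2 \<and> a1' = a2 \<and> a2' = a1 \<and>
     y \<noteq> a1 \<and>
     w' = w \<and> y' = y \<and> z' = z * ((y - a2) / (y - a1))"

definition T_a2_l1 :: "complex \<Rightarrow> conn \<Rightarrow> conn \<Rightarrow> bool" where
  "T_a2_l1 q = S_a1_a2 OO T_a1_l1 q OO S_a1_a2"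

fun T_k1_l1 :: "complex \<Rightarrow> conn \<Rightarrow> conn \<Rightarrow> bool" where
  "T_k1_l1 q (Conn k1 k2 l1 l2 a1 a2 w y z) (Conn k1' k2' l1' l2' a1' a2' w' y' z') \<longleftrightarrow>
     admissible_conn (Conn k1 k2 l1 l2 a1 a2 w y z) \<and>
     admissible_conn (Conn k1' k2' l1' l2' a1' a2' w' y' z') \<and>
     k1' = q * k1 \<and> k2' = k2 \<and> l1' = q * l1 \<and> l2' = l2 \<and> a1' = a1 \<and> a2' = a2 \<and>
     q * y ^ 2 * k1 - y * z * k2 \<noteq> 0 \<and> z' \<noteq> 1 \<and>
     w' = w * (z' - 1) * (q * y * k1 - z * k2) / (z * k1) \<and>
     y' * y = z * (z' * a2 * k2 + q * l1) / (q * (z' - 1) * k1) \<and>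
     z' = (q * y * a1 * k1 + q * z * l1) / (q * y ^ 2 * k1 - y * z * k2)"

text \<open>
  The source prints \<open>k2 - q y k1\<close> for \<open>z k2 - q y k1\<close> in the last
  equation below, and \<open>z' (z' a2 k2 + q l1)\<close> (the numerator belonging to
  \<open>T_a1_l1\<close>) for \<open>z' (z a2 k2 + l1)\<close> in the one for \<open>y' y\<close>. The printed
  map does not commute with \<open>T_a1_l1\<close>, \<open>T_a2_l1\<close>, \<open>T_k1_l1\<close> in the
  variables \<open>y\<close>, \<open>z\<close>; the one below does. The auxiliary variable
  \<open>w\<close>, which enters no change of variables, is transformed as printed.
\<close>

fun T_k1_l2 :: "complex \<Rightarrow> conn \<Rightarrow> conn \<Rightarrow> bool" where
  "T_k1_l2 q (Conn k1 k2 l1 l2 a1 a2 w y z) (Conn k1' k2' l1' l2' a1' a2' w' y' z') \<longleftrightarrow>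
     admissible_conn (Conn k1 k2 l1 l2 a1 a2 w y z) \<and>
     admissible_conn (Conn k1' k2' l1' l2' a1' a2' w' y' z') \<and>
     k1' = q * k1 \<and> k2' = k2 \<and> l1' = l1 \<and> l2' = q * l2 \<and> a1' = a1 \<and> a2' = a2 \<and>
     a2 * (z * k2 - q * y * k1) + l1 \<noteq> 0 \<and> z' \<noteq> 1 \<and>
     w' = - w * (z' - 1) \<and>
     y * y' = z' * (z * a2 * k2 + l1) / (q * (z' - 1) * k1) \<and>
     z' * z = - (q * k1 * (z * a1 * a2 * k2 + (a1 - y) * l1))
                / (k2 * (a2 * (z * k2 - q * y * k1) + l1))"

section \<open>Translations of type $(A_2+A_1)^{(1)}$\<close>

datatype sym = Sym complex complex complex complex complex complex

text \<open>
  A point is \<open>Sym b0 b1 b2 f0 f1 f2\<close>. The constant \<open>c\<close> enters all formulas only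
  through its square, which is determined by \<open>f0 * f1 * f2 = q * c ^ 2\<close>.
\<close>

fun c_squared :: "complex \<Rightarrow> sym \<Rightarrow> complex" where
  "c_squared q (Sym b0 b1 b2 f0 f1 f2) = f0 * f1 * f2 / q"

fun admissible_sym :: "complex \<Rightarrow> sym \<Rightarrow> bool" where
  "admissible_sym sq (Sym b0 b1 b2 f0 f1 f2) \<longleftrightarrow>
     b0 \<noteq> 0 \<and> b1 \<noteq> 0 \<and> b2 \<noteq> 0 \<and> f0 \<noteq> 0 \<and> f1 \<noteq> 0 \<and> f2 \<noteq> 0 \<and> b0 * b1 * b2 = sq"

text \<open>
  The parameter shift is the one for which these equations are the symmetric form of the third
  \<open>q\<close>-Painleve equation, for which \<open>T0 \<circ> T1 \<circ> T2\<close> is the identity, and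
  which matches the action of \<open>T_a1_l1\<inverse>\<inverse>\<close> on \<open>a1 / a2\<close>:
  \<open>b0\<close> is divided, and \<open>b1\<close> multiplied, by \<open>sq\<close>. The opposite shift,
  and \<open>f0\<close> in place of \<open>f0'\<close> in the last denominator, are misprints in the
  source.
\<close>

fun T0 :: "complex \<Rightarrow> complex \<Rightarrow> sym \<Rightarrow> sym \<Rightarrow> bool" where
  "T0 q sq (Sym b0 b1 b2 f0 f1 f2) (Sym b0' b1' b2' f0' f1' f2') \<longleftrightarrow>
     admissible_sym sq (Sym b0 b1 b2 f0 f1 f2) \<and>
     admissible_sym sq (Sym b0' b1' b2' f0' f1' f2') \<and>
     b0' = b0 / sq \<and> b1' = sq * b1 \<and> b2' = b2 \<and>
     b1 * f1 + 1 \<noteq> 0 \<and> b0 + sq * f0' \<noteq> 0 \<and>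
     (let c2 = c_squared q (Sym b0 b1 b2 f0 f1 f2) in
        f0' * f0 = q * c2 * (b1 + f1) / (f1 * (b1 * f1 + 1)) \<and>
        f1' * f1 = q * c2 * (b0 * f0' + sq) / (f0' * (b0 + sq * f0')) \<and>
        f0' * f1' * f2' = q * c2)"

fun sigma0 :: "sym \<Rightarrow> sym" where
  "sigma0 (Sym b0 b1 b2 f0 f1 f2) = Sym b2 b0 b1 f2 f0 f1"

fun sigma1 :: "sym \<Rightarrow> sym" where
  "sigma1 (Sym b0 b1 b2 f0 f1 f2) = Sym b0 b1 b2 (1 / f0) (1 / f1) (1 / f2)"

fun w0 :: "complex \<Rightarrow> sym \<Rightarrow> sym \<Rightarrow> bool" where
  "w0 sq (Sym b0 b1 b2 f0 f1 f2) (Sym b0' b1' b2' f0' f1' f2') \<longleftrightarrow>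
     admissible_sym sq (Sym b0 b1 b2 f0 f1 f2) \<and>
     admissible_sym sq (Sym b0' b1' b2' f0' f1' f2') \<and>
     b0' = b0 \<and> b1' = b1 \<and> b2' = b2 \<and>
     b0 * b1 + b0 * f1 + f0 * f1 \<noteq> 0 \<and>
     b1 * b2 + b1 * f2 + f1 * f2 \<noteq> 0 \<and>
     b2 * b0 + b2 * f0 + f2 * f0 \<noteq> 0 \<and>
     f0' = b0 * b1 * (b2 * b0 + b2 * f0 + f2 * f0) / (f2 * (b0 * b1 + b0 * f1 + f0 * f1)) \<and>
     f1' = b1 * b2 * (b0 * b1 + b0 * f1 + f0 * f1) / (f0 * (b1 * b2 + b1 * f2 + f1 * f2)) \<and>
     f2' = b2 * b0 * (b1 * b2 + b1 * f2 + f1 * f2) / (f1 * (b2 * b0 + b2 * f0 + f2 * f0))"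

definition graph_of :: "('a \<Rightarrow> 'b) \<Rightarrow> 'a \<Rightarrow> 'b \<Rightarrow> bool" where
  "graph_of f x y \<longleftrightarrow> y = f x"

text \<open>\<open>T1\<close> is \<open>sigma0 \<circ> T0 \<circ> sigma0\<^sup>2\<close> and \<open>T2\<close> is
  \<open>sigma0\<^sup>2 \<circ> T0 \<circ> sigma0\<close>.\<close>

definition T1 :: "complex \<Rightarrow> complex \<Rightarrow> sym \<Rightarrow> sym \<Rightarrow> bool" where
  "T1 q sq = graph_of sigma0 OO graph_of sigma0 OO T0 q sq OO graph_of sigma0"

definition T2 :: "complex \<Rightarrow> complex \<Rightarrow> sym \<Rightarrow> sym \<Rightarrow> bool" where
  "T2 q sq = graph_of sigma0 OO T0 q sq OO graph_of sigma0 OO graph_of sigma0"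

text \<open>
  On functions of the variables, \<open>T3\<close> is the composite of the substitutions \<open>sigma1\<close>
  and \<open>w0\<close> with \<open>w0\<close> performed first; on points \<open>sigma1\<close> therefore acts first.
  Since \<open>w0\<close> sends the product \<open>f0 * f1 * f2\<close> to \<open>q / (f0 * f1 * f2)\<close>,
  this is the order for which \<open>c ^ 2\<close> goes to \<open>q * c ^ 2\<close>.
\<close>

definition T3 :: "complex \<Rightarrow> sym \<Rightarrow> sym \<Rightarrow> bool" where
  "T3 sq = graph_of sigma1 OO w0 sq"

section \<open>Changes of variables\<close>

text \<open>
  The square roots of the \<open>b\<close>-variables are not unique and the \<open>conn\<close>-variables carry
  a gauge freedom, so each change of variables is a relation that is a function in neither direction.
\<close>

fun corr_I :: "complex \<Rightarrow> complex \<Rightarrow> conn \<Rightarrow> sym \<Rightarrow> bool" where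
  "corr_I q sq (Conn k1 k2 l1 l2 a1 a2 w y z) (Sym b0 b1 b2 f0 f1 f2) \<longleftrightarrow>
     admissible_conn (Conn k1 k2 l1 l2 a1 a2 w y z) \<and>
     admissible_sym sq (Sym b0 b1 b2 f0 f1 f2) \<and>
     y = - a1 / (b0 * f0) \<and> z = - f1 / b1 \<and>
     b0 ^ 2 = a1 / a2 \<and> b1 ^ 2 = - a2 * k2 / l1 \<and>
     c_squared q (Sym b0 b1 b2 f0 f1 f2) = a1 * a2 * k1 / (sq * l1)"

fun corr_II :: "complex \<Rightarrow> complex \<Rightarrow> conn \<Rightarrow> sym \<Rightarrow> bool" where
  "corr_II q sq (Conn k1 k2 l1 l2 a1 a2 w y z) (Sym b0 b1 b2 f0 f1 f2) \<longleftrightarrow>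
     admissible_conn (Conn k1 k2 l1 l2 a1 a2 w y z) \<and>
     admissible_sym sq (Sym b0 b1 b2 f0 f1 f2) \<and>
     y = - a1 * b0 * b1 * f0 * f1 / (c_squared q (Sym b0 b1 b2 f0 f1 f2) * (q * sq)) \<and>
     z = - f0 / b0 \<and>
     b0 ^ 2 = - a2 * k2 / l1 \<and> b1 ^ 2 = - q * l1 / (a1 * k2) \<and>
     c_squared q (Sym b0 b1 b2 f0 f1 f2) = a1 * a2 * k1 / (sq * l1)"

fun corr_III :: "complex \<Rightarrow> complex \<Rightarrow> conn \<Rightarrow> sym \<Rightarrow> bool" where
  "corr_III q sq (Conn k1 k2 l1 l2 a1 a2 w y z) (Sym b0 b1 b2 f0 f1 f2) \<longleftrightarrow>
     admissible_conn (Conn k1 k2 l1 l2 a1 a2 w y z) \<and>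
     admissible_sym sq (Sym b0 b1 b2 f0 f1 f2) \<and>
     y = - a2 * b1 / f1 \<and> z = q * a1 * k1 / (b0 * b1 * f0 * f1 * k2) \<and>
     b0 ^ 2 = - q * l1 / (a1 * k2) \<and> b1 ^ 2 = a1 / a2 \<and>
     c_squared q (Sym b0 b1 b2 f0 f1 f2) = a1 * a2 * k1 / (sq * l1)"

fun corr_I' :: "complex \<Rightarrow> complex \<Rightarrow> conn \<Rightarrow> sym \<Rightarrow> bool" where
  "corr_I' q sq (Conn k1 k2 l1 l2 a1 a2 w y z) (Sym b0 b1 b2 f0 f1 f2) \<longleftrightarrow>
     admissible_conn (Conn k1 k2 l1 l2 a1 a2 w y z) \<and>
     admissible_sym sq (Sym b0 b1 b2 f0 f1 f2) \<and>
     y = - a2 * b0 * f0 \<and> z = - 1 / (b1 * f1) \<and>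
     b0 ^ 2 = a1 / a2 \<and> b1 ^ 2 = - a2 * k2 / l1 \<and>
     c_squared q (Sym b0 b1 b2 f0 f1 f2) = l1 / (q * sq * a1 * a2 * k1)"

text \<open>The next two arise from \<open>corr_II\<close> and \<open>corr_III\<close> as \<open>corr_I'\<close> does
  from \<open>corr_I\<close>, by inverting the \<open>f\<close>-variables and \<open>q * c ^ 2\<close>.\<close>

fun corr_II' :: "complex \<Rightarrow> complex \<Rightarrow> conn \<Rightarrow> sym \<Rightarrow> bool" where
  "corr_II' q sq (Conn k1 k2 l1 l2 a1 a2 w y z) (Sym b0 b1 b2 f0 f1 f2) \<longleftrightarrow>
     admissible_conn (Conn k1 k2 l1 l2 a1 a2 w y z) \<and>
     admissible_sym sq (Sym b0 b1 b2 f0 f1 f2) \<and>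
     y = - a1 * b0 * b1 * c_squared q (Sym b0 b1 b2 f0 f1 f2) * sq / (f0 * f1) \<and>
     z = - 1 / (b0 * f0) \<and>
     b0 ^ 2 = - a2 * k2 / l1 \<and> b1 ^ 2 = - q * l1 / (a1 * k2) \<and>
     c_squared q (Sym b0 b1 b2 f0 f1 f2) = l1 / (q * sq * a1 * a2 * k1)"

fun corr_III' :: "complex \<Rightarrow> complex \<Rightarrow> conn \<Rightarrow> sym \<Rightarrow> bool" where
  "corr_III' q sq (Conn k1 k2 l1 l2 a1 a2 w y z) (Sym b0 b1 b2 f0 f1 f2) \<longleftrightarrow>
     admissible_conn (Conn k1 k2 l1 l2 a1 a2 w y z) \<and>
     admissible_sym sq (Sym b0 b1 b2 f0 f1 f2) \<and>
     y = - a2 * b1 * f1 \<and> z = q * a1 * k1 * f0 * f1 / (b0 * b1 * k2) \<and>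
     b0 ^ 2 = - q * l1 / (a1 * k2) \<and> b1 ^ 2 = a1 / a2 \<and>
     c_squared q (Sym b0 b1 b2 f0 f1 f2) = l1 / (q * sq * a1 * a2 * k1)"

definition change_of_variables :: "complex \<Rightarrow> (conn \<Rightarrow> sym \<Rightarrow> bool) \<Rightarrow> bool" where
  "change_of_variables sq R \<longleftrightarrow>
     (\<forall>S. admissible_conn S \<longrightarrow> (\<exists>B. R S B)) \<and>
     (\<forall>B. admissible_sym sq B \<longrightarrow> (\<exists>S. R S B))"

text \<open>
  Whenever the deformation \<open>T\<close> takes \<open>S\<close> to \<open>S'\<close>, the translation \<open>U\<close> takes
  every point that corresponds to \<open>S\<close> to one that corresponds to \<open>S'\<close>, and likewise
  for the inverse evolutions. This property is closed under composition and inversion of the pairs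
  \<open>(T, U)\<close>, so it extends from generators to the lattices they generate. The converse
  requirement, that \<open>T\<close> be defined whenever \<open>U\<close> is, only holds generically: the
  formulas for \<open>T_k1_l2\<close>, and the conjugation in \<open>T_a2_l1\<close>, have points of
  indeterminacy at which the translations are regular.
\<close>

definition corresponds ::
    "(conn \<Rightarrow> sym \<Rightarrow> bool) \<Rightarrow> (conn \<Rightarrow> conn \<Rightarrow> bool) \<Rightarrow> (sym \<Rightarrow> sym \<Rightarrow> bool) \<Rightarrow> bool" where
  "corresponds R T U \<longleftrightarrow>
     (\<forall>S S'. T S S' \<longrightarrow>
        (\<forall>B. R S B \<longrightarrow> (\<exists>B'. U B B' \<and> R S' B')) \<and>
        (\<forall>B'. R S' B' \<longrightarrow> (\<exists>B. U B B' \<and> R S B)))"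

definition aligned ::
    "(conn \<Rightarrow> sym \<Rightarrow> bool) \<Rightarrow> (sym \<Rightarrow> sym \<Rightarrow> bool) list \<Rightarrow> (conn \<Rightarrow> conn \<Rightarrow> bool) list \<Rightarrow> bool" where
  "aligned R Us Ts \<longleftrightarrow> list_all2 (\<lambda>U T. corresponds R T U) Us Ts"

end

theory Submission
  imports Defs
begin

text \<open>
  Under (I) the symmetric variables are determined by the deformation variables and a choice of the
  square roots \<open>b0\<close>, \<open>b1\<close>. Each deformation rescales these roots by fixed factors,
  so for (I) a correspondence amounts to a rational identity, checked for the four
  generators after clearing denominators. Everything else follows by symmetry: the changes of
  variables (II) and (III) are (I) composed with \<open>sigma0\<close> and \<open>sigma0\<^sup>2\<close>, and
  \<open>sigma0\<close> permutes \<open>T0\<close>, \<open>T1\<close>, \<open>T2\<close> cyclically and commutes with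
  \<open>T3\<close>; the primed ones arise by composing with \<open>sigma1\<close>, which commutes with the
  first three translations and, \<open>w0\<close> being an involution, conjugates \<open>T3\<close> to its inverse.
\<close>

section \<open>Change of variables (I) in solved form\<close>

fun roots_I :: "conn \<Rightarrow> complex \<Rightarrow> complex \<Rightarrow> bool" where
  "roots_I (Conn k1 k2 l1 l2 a1 a2 w y z) b0 b1 \<longleftrightarrow> b0 ^ 2 = a1 / a2 \<and> b1 ^ 2 = - a2 * k2 / l1"

text \<open>The constraint \<open>b0 * b1 * b2 = sq\<close> yields \<open>b2\<close>, the equations
  for \<open>y\<close> and \<open>z\<close> yield \<open>f0\<close> and \<open>f1\<close>, and the
  prescribed value of \<open>c ^ 2\<close> then yields \<open>f2\<close>, with
  \<open>q / sq = sq\<close>. The right side is an explicit recipe, so finding a corresponding point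
  reduces to choosing \<open>b0\<close> and \<open>b1\<close>.\<close>

lemma corr_I_iff:
  assumes "q \<noteq> 0" "sq ^ 2 = q"
  shows "corr_I q sq (Conn k1 k2 l1 l2 a1 a2 w y z) (Sym b0 b1 b2 f0 f1 f2) \<longleftrightarrow>
    admissible_conn (Conn k1 k2 l1 l2 a1 a2 w y z) \<and>
    roots_I (Conn k1 k2 l1 l2 a1 a2 w y z) b0 b1 \<and>
    b2 = sq / (b0 * b1) \<and> f0 = - a1 / (b0 * y) \<and> f1 = - b1 * z \<and>
    f2 = sq * a2 * k1 * b0 * y / (l1 * b1 * z)"
proof -
  have s: "sq \<noteq> 0" "q = sq * sq" using assms by (auto simp: power2_eq_square)
  show ?thesis
    using s(1) unfolding s(2)
    by (auto simp: power2_eq_square field_simps)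
qed

lemma corr_I_exists:
  assumes "q \<noteq> 0" "sq ^ 2 = q" "admissible_conn S" "roots_I S b0 b1"
  shows "\<exists>b2 f0 f1 f2. corr_I q sq S (Sym b0 b1 b2 f0 f1 f2)"
  using assms(3,4)
  by (cases S) (simp add: corr_I_iff[OF assms(1,2)] del: corr_I.simps admissible_conn.simps)

text \<open>Solving for the deformation variables leaves only \<open>l1\<close>, \<open>a2\<close> and \<open>w\<close> free.\<close>

lemma corr_I_parametrization:
  assumes q: "q \<noteq> 0" "sq ^ 2 = q"
    and "corr_I q sq (Conn k1 k2 l1 l2 a1 a2 w y z) (Sym b0 b1 b2 f0 f1 f2)"
  shows "a1 = b0 ^ 2 * a2" "k2 = - (b1 ^ 2 * l1 / a2)" "k1 = f0 * f1 * f2 * l1 / (sq * b0 ^ 2 * a2 ^ 2)"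
   "y = - (b0 * a2 / f0)" "z = - (f1 / b1)" "b2 = sq / (b0 * b1)"
   "b0 \<noteq> 0" "b1 \<noteq> 0" "f0 \<noteq> 0" "f1 \<noteq> 0" "f2 \<noteq> 0" "l1 \<noteq> 0" "a2 \<noteq> 0" "w \<noteq> 0" "sq \<noteq> 0"
proof -
  have s: "sq \<noteq> 0" "q = sq * sq" using assms by (auto simp: power2_eq_square)
  show "a1 = b0 ^ 2 * a2" "k2 = - (b1 ^ 2 * l1 / a2)" "k1 = f0 * f1 * f2 * l1 / (sq * b0 ^ 2 * a2 ^ 2)"
   "y = - (b0 * a2 / f0)" "z = - (f1 / b1)" "b2 = sq / (b0 * b1)"
   "b0 \<noteq> 0" "b1 \<noteq> 0" "f0 \<noteq> 0" "f1 \<noteq> 0" "f2 \<noteq> 0" "l1 \<noteq> 0" "a2 \<noteq> 0" "w \<noteq> 0" "sq \<noteq> 0"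
    using s assms(3) by (auto simp: power2_eq_square field_simps)
qed

section \<open>The four generators in the coordinates of (I)\<close>

lemma corr_I_admissible:
  "corr_I q sq S B \<Longrightarrow> admissible_conn S" "corr_I q sq S B \<Longrightarrow> admissible_sym sq B"
  by (cases S; cases B; simp)+

text \<open>Replacing \<open>q * c ^ 2\<close> by either product of the \<open>f\<close>-variables lowers the degrees.\<close>

lemma T0_I:
  assumes "q \<noteq> 0"
    "admissible_sym sq (Sym b0 b1 b2 f0 f1 f2)" "admissible_sym sq (Sym b0' b1' b2' f0' f1' f2')"
    "b0 = sq * b0'" "b1' = sq * b1" "b2' = b2" "b1 * f1 + 1 \<noteq> 0" "b0 + sq * f0' \<noteq> 0"
    and e: "f0' * f1' * f2' = f0 * f1 * f2" "f0' * (b1 * f1 + 1) = f2 * (b1 + f1)"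
    "f1 * (b0 + sq * f0') = f2' * (b0 * f0' + sq)"
  shows "T0 q sq (Sym b0 b1 b2 f0 f1 f2) (Sym b0' b1' b2' f0' f1' f2')"
proof -
  have [simp]: "f0 \<noteq> 0" "f1 \<noteq> 0" "f2 \<noteq> 0" "f0' \<noteq> 0" "f1' \<noteq> 0" "f2' \<noteq> 0" "sq \<noteq> 0"
    using assms(2,3) by auto
  have "f0' * f0 = f0 * f1 * f2 * (b1 + f1) / (f1 * (b1 * f1 + 1))"
    using e(2) assms(7) by (simp add: divide_simps mult_ac)
  moreover have "f1' * f1 = f0 * f1 * f2 * (b0 * f0' + sq) / (f0' * (b0 + sq * f0'))"
  proof -
    have "f1' * f1 * (f0' * (b0 + sq * f0')) = f0 * f1 * f2 * (b0 * f0' + sq)"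
      unfolding e(1)[symmetric] using e(3) by (simp add: mult_ac)
    then show ?thesis using assms(8) by (simp add: eq_divide_eq)
  qed
  ultimately show ?thesis using assms by (simp add: Let_def)
qed

text \<open>\<open>T_a1_l1\<close> multiplies \<open>a1 / a2\<close> by \<open>q\<close> and divides
  \<open>a2 * k2 / l1\<close> by \<open>q\<close>, so the matching roots are scaled by
  \<open>sq\<close> and \<open>1 / sq\<close>. \<open>T0\<close> runs from the primed point to the
  unprimed one because it corresponds to the inverse deformation.\<close>

lemma T_a1_l1_imp_T0:
  assumes q: "q \<noteq> 0" "sq ^ 2 = q" and T: "T_a1_l1 q S S'"
    and B: "corr_I q sq S (Sym b0 b1 b2 f0 f1 f2)"
    and B': "corr_I q sq S' (Sym (sq * b0) (1 / sq * b1) b2' f0' f1' f2')"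
  shows "T0 q sq (Sym (sq * b0) (1 / sq * b1) b2' f0' f1' f2') (Sym b0 b1 b2 f0 f1 f2)"
proof -
  obtain k1 k2 l1 l2 a1 a2 w y z where S: "S = Conn k1 k2 l1 l2 a1 a2 w y z" by (cases S)
  obtain k1' k2' l1' l2' a1' a2' w' y' z' where S': "S' = Conn k1' k2' l1' l2' a1' a2' w' y' z'"
    by (cases S')
  note p = corr_I_parametrization[OF q B[unfolded S]]
  note p' = corr_I_parametrization[OF q B'[unfolded S']]
  have s: "q = sq * sq" using q by (simp add: power2_eq_square)
  have t: "k1' = k1" "l1' = q * l1" "a2' = a2" "y \<noteq> a2" "z' \<noteq> 1"
     "y' * y * (q * (z' - 1) * k1) = z' * (z' * a2 * k2 + q * l1)"
     "z' * z * ((y - a2) * k2) = q * y * (y - a1) * k1"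
    using T q(1) unfolding S S' by auto
  \<comment> \<open>In these coordinates \<open>y = a2\<close> reads \<open>f0 = - b0\<close> and
    \<open>z' = 1\<close> reads \<open>sq * f1' = - b1\<close>, so the two conditions on the
    deformation become \<open>n1\<close> and \<open>n2\<close>.\<close>
  have n1: "f0 + b0 \<noteq> 0"
  proof
    assume "f0 + b0 = 0"
    then have "f0 = - b0" by (simp add: eq_neg_iff_add_eq_0)
    then show False using t(4) p by simp
  qed
  have n2: "b1 + sq * f1' \<noteq> 0"
  proof
    assume "b1 + sq * f1' = 0"
    then have "b1 = - (sq * f1')" by (simp add: eq_neg_iff_add_eq_0)
    then show False using t(5) p p' by simp
  qed
  have e0: "f0' * f1' * f2' = f0 * f1 * f2"
    using t(1) unfolding p(3) p'(3) t(2,3) s using p p'(7-) by (auto simp: field_simps power2_eq_square)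
  \<comment> \<open>The leading monomial is the common factor that clearing denominators leaves.
    Here \<open>k1\<close> is expressed through the primed product of the
    \<open>f\<close>-variables, and in the identity from \<open>t(7)\<close> through the unprimed
    one; this leaves the single cofactors \<open>f2'\<close> and \<open>f2\<close>.\<close>
  have "(a2 ^ 2 * b0 ^ 2 * b1 * f0' * f1' * l1 * sq ^ 3) * (f0 * (b1 * f1' + sq))
     = (a2 ^ 2 * b0 ^ 2 * b1 * f0' * f1' * l1 * sq ^ 3) * (f2' * (b1 + sq * f1'))"
    using t(6) unfolding t(1)[symmetric] p(2,4,5) p'(3-5) t(2,3) s using p(7-) p'(7-) n1 n2
    by (simp add: field_simps power2_eq_square power3_eq_cube power4_eq_xxxx)
  then have e1: "f0 * (b1 * f1' + sq) = f2' * (b1 + sq * f1')"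
    using p(7-) p'(7-) by simp
  have "(a2 ^ 3 * b0 ^ 2 * b1 ^ 2 * f0 ^ 2 * f1 * l1 * sq ^ 2) * (f1' * (b0 + f0))
     = (a2 ^ 3 * b0 ^ 2 * b1 ^ 2 * f0 ^ 2 * f1 * l1 * sq ^ 2) * (f2 * (b0 * f0 + 1))"
    using t(7) unfolding p(1-5) p'(3-5) t(2,3) s using p(7-) p'(7-)
    by (simp add: field_simps power2_eq_square power3_eq_cube power4_eq_xxxx)
  then have e2: "f1' * (b0 + f0) = f2 * (b0 * f0 + 1)" using p(7-) by simp
  \<comment> \<open>This is the first denominator of \<open>T0\<close> up to the factor
    \<open>sq\<close>. No condition of \<open>T_a1_l1\<close> states it directly; it follows from
    \<open>e1\<close>, since \<open>f2'\<close> and \<open>b1 + sq * f1'\<close> are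
    nonzero.\<close>
  have "b1 * f1' + sq \<noteq> 0" using e1 n2 p'(11) by auto
  then have "1 / sq * b1 * f1' + 1 \<noteq> 0"
    using p(15) by (auto simp: field_simps)
  moreover have "sq * b0 + sq * f0 \<noteq> 0"
    using n1 p(15) unfolding distrib_left[symmetric] by (simp add: add.commute)
  moreover have "f0 * (1 / sq * b1 * f1' + 1) = f2' * (1 / sq * b1 + f1')"
    using e1 p(15) by (simp add: field_simps)
  moreover have "f1' * (sq * b0 + sq * f0) = f2 * (sq * b0 * f0 + sq)"
    using e2 by algebra
  moreover have "b2 = b2'" "b1 = sq * (1 / sq * b1)"
    using p(6-8,15) p'(6) by auto
  ultimately show ?thesis
    using T0_I[OF q(1) corr_I_admissible(2)[OF B'] corr_I_admissible(2)[OF B]] e0[symmetric] by blast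
qed

text \<open>\<open>sigma0\<close> has order three, so the factors around \<open>T0\<close> are
  mutually inverse, and \<open>T1\<close> is \<open>T0\<close> in cyclically shifted coordinates.
  The same holds for \<open>T2\<close> with the other shift.\<close>

lemma T1_iff: "T1 q sq B B' \<longleftrightarrow> T0 q sq (sigma0 (sigma0 B)) (sigma0 (sigma0 B'))"
proof (cases B')
  case (Sym b0 b1 b2 f0 f1 f2)
  then have "sigma0 C = B' \<longleftrightarrow> C = sigma0 (sigma0 B')" for C
    by (cases C) auto
  then show ?thesis
    unfolding T1_def OO_def graph_of_def by (metis (no_types, lifting))
qed

lemma T2_iff: "T2 q sq B B' \<longleftrightarrow> T0 q sq (sigma0 B) (sigma0 B')"
proof (cases B')
  case (Sym b0 b1 b2 f0 f1 f2)
  then have "sigma0 (sigma0 C) = B' \<longleftrightarrow> C = sigma0 B'" for C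
    by (cases C) auto
  then show ?thesis
    unfolding T2_def OO_def graph_of_def by (metis (no_types, lifting))
qed

lemma T3_iff: "T3 sq B B' \<longleftrightarrow> w0 sq (sigma1 B) B'"
  by (auto simp: T3_def OO_def graph_of_def)

text \<open>Here \<open>a1 / a2\<close> is fixed and \<open>a2 * k2 / l1\<close> is divided by
  \<open>q\<close>, hence the factors \<open>1\<close> and \<open>1 / sq\<close>. In the coordinates
  shifted twice by \<open>sigma0\<close>, the equation for \<open>z'\<close> becomes the first
  equation of \<open>T0\<close> and the one for \<open>y'\<close> becomes the second.\<close>

lemma T_k1_l1_imp_T1:
  assumes q: "q \<noteq> 0" "sq ^ 2 = q" and T: "T_k1_l1 q S S'"
    and B: "corr_I q sq S (Sym b0 b1 b2 f0 f1 f2)"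
    and B': "corr_I q sq S' (Sym (1 * b0) (1 / sq * b1) b2' f0' f1' f2')"
  shows "T1 q sq (Sym b0 b1 b2 f0 f1 f2) (Sym (1 * b0) (1 / sq * b1) b2' f0' f1' f2')"
proof -
  obtain k1 k2 l1 l2 a1 a2 w y z where S: "S = Conn k1 k2 l1 l2 a1 a2 w y z" by (cases S)
  obtain k1' k2' l1' l2' a1' a2' w' y' z' where S': "S' = Conn k1' k2' l1' l2' a1' a2' w' y' z'"
    by (cases S')
  note p = corr_I_parametrization[OF q B[unfolded S]]
  note p' = corr_I_parametrization[OF q B'[unfolded S']]
  have s: "q = sq * sq" using q by (simp add: power2_eq_square)
  have t: "k1' = q * k1" "l1' = q * l1" "a2' = a2" "q * y ^ 2 * k1 - y * z * k2 \<noteq> 0" "z' \<noteq> 1"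
     "y' * y * (q * (z' - 1) * k1) = z * (z' * a2 * k2 + q * l1)"
     "z' * (q * y ^ 2 * k1 - y * z * k2) = q * y * a1 * k1 + q * z * l1"
    using T q(1) unfolding S S' by auto
  have n1: "sq * f2 + b0 * b1 \<noteq> 0"
  proof -
    have "q * y ^ 2 * k1 - y * z * k2 = f1 * l1 / f0 * (sq * f2 + b0 * b1)"
      unfolding p(1-5) s using p(7-) by (simp add: field_simps power2_eq_square)
    then show ?thesis using t(4) by auto
  qed
  have n2: "b1 + sq * f1' \<noteq> 0"
  proof
    assume "b1 + sq * f1' = 0"
    then have "b1 = - (sq * f1')" by (simp add: eq_neg_iff_add_eq_0)
    then show False using t(5) p p' by simp
  qed
  have e0: "f0' * f1' * f2' = f0 * f1 * f2"
    using t(1) unfolding p(3) p'(3) t(2,3) s using p p'(7-) by (auto simp: field_simps power2_eq_square)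
  have "(a2 ^ 2 * b0 ^ 2 * b1 * f0 * f1 * l1 * sq ^ 2) * (f2 * (b1 + sq * f1'))
     = (a2 ^ 2 * b0 ^ 2 * b1 * f0 * f1 * l1 * sq ^ 2) * (f0' * (b1 * f1' + sq))"
    using t(6) unfolding p(2-5) p'(3-5) t(2,3) s using p(7-) p'(7-)
    by (simp add: field_simps power2_eq_square power3_eq_cube power4_eq_xxxx)
  then have e1: "f2 * (b1 + sq * f1') = f0' * (b1 * f1' + sq)" using p(7-) by simp
  have "(b1 * f1 * l1 * sq) * (f1' * (sq * f2 + b0 * b1))
     = (b1 * f1 * l1 * sq) * (f0 * (sq + b0 * b1 * f2))"
    using t(7) unfolding p(1-5) p'(3-5) t(2,3) s using p(7-) p'(7-)
    by (simp add: field_simps power2_eq_square power4_eq_xxxx)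
  then have e2: "f1' * (sq * f2 + b0 * b1) = f0 * (sq + b0 * b1 * f2)"
    unfolding mult_cancel_left using p(7-) by auto
  \<comment> \<open>Writing \<open>sq\<close> as \<open>b0 * b1 * b2\<close> splits
    \<open>b0 * b1\<close> off both sides of \<open>e2\<close>. What remains is the first equation
    of \<open>T0\<close> with \<open>b2\<close>, \<open>f2\<close> in the place of
    \<open>b1\<close>, \<open>f1\<close>.\<close>
  have "sq * f2 + b0 * b1 = b0 * b1 * (b2 * f2 + 1)"
    using p(6-8) by (simp add: field_simps)
  then have "b2 * f2 + 1 \<noteq> 0" using n1 by auto
  moreover have "b0 * b1 * b2 = sq" using p(6-8) by simp
  then have "b0 * b1 * (f1' * (b2 * f2 + 1)) = b0 * b1 * (f0 * (b2 + f2))"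
    using e2 by (simp flip: \<open>b0 * b1 * b2 = sq\<close> add: algebra_simps)
  then have "f1' * (b2 * f2 + 1) = f0 * (b2 + f2)"
    unfolding mult_cancel_left using p(7,8) by auto
  moreover have "b2' = sq * b2" "1 * b0 = b0" "b1 = sq * (1 / sq * b1)"
    using p(6-8,15) p'(6) by auto
  moreover have "f1' * f2' * f0' = f1 * f2 * f0" using e0 by (simp add: mult_ac)
  moreover have "admissible_sym sq (Sym b1 b2 b0 f1 f2 f0)"
    "admissible_sym sq (Sym (1 / sq * b1) b2' (1 * b0) f1' f2' f0')"
    using corr_I_admissible(2)[OF B] corr_I_admissible(2)[OF B'] by auto
  ultimately show ?thesis
    unfolding T1_iff sigma0.simps using T0_I[OF q(1)] e1 n2 by blast
qed

text \<open>The conjugating factor \<open>(y - a2) / (y - a1)\<close> cancels against the quotient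
  in the equation for \<open>z\<close>, so the intermediate coordinate \<open>Z\<close> is the
  monomial \<open>- sq * f2 / (b0 * b1)\<close>. The remaining equations then become those of
  \<open>T0\<close> in the coordinates shifted by \<open>sigma0\<close>.\<close>

lemma T_a2_l1_imp_T2:
  assumes q: "q \<noteq> 0" "sq ^ 2 = q" and T: "T_a2_l1 q S S'"
    and B: "corr_I q sq S (Sym b0 b1 b2 f0 f1 f2)"
    and B': "corr_I q sq S' (Sym (1 / sq * b0) (1 * b1) b2' f0' f1' f2')"
  shows "T2 q sq (Sym (1 / sq * b0) (1 * b1) b2' f0' f1' f2') (Sym b0 b1 b2 f0 f1 f2)"
proof -
  obtain k1 k2 l1 l2 a1 a2 w y z where S: "S = Conn k1 k2 l1 l2 a1 a2 w y z" by (cases S)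
  obtain k1' k2' l1' l2' a1' a2' w' y' z' where S': "S' = Conn k1' k2' l1' l2' a1' a2' w' y' z'"
    by (cases S')
  note p = corr_I_parametrization[OF q B[unfolded S]]
  note p' = corr_I_parametrization[OF q B'[unfolded S']]
  have s: "q = sq * sq" using q by (simp add: power2_eq_square)
  obtain S1 S1' where T': "S_a1_a2 S S1" "T_a1_l1 q S1 S1'" "S_a1_a2 S1' S'"
    using T unfolding T_a2_l1_def by blast
  obtain z1 w1 Z where S1: "S1 = Conn k1 k2 l1 l2 a2 a1 w y z1"
      "S1' = Conn k1 k2 (q * l1) l2 (q * a2) a1 w1 y' Z"
    using T' unfolding S S' by (cases S1; cases S1') auto
  \<comment> \<open>\<open>y\<close> avoids \<open>a2\<close> because \<open>z1\<close> would vanish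
    otherwise; in the same way \<open>y'\<close> avoids \<open>a1\<close> in \<open>t\<close>,
    because \<open>z'\<close> is nonzero.\<close>
  have z1: "y \<noteq> a1" "z1 * (y - a1) = z * (y - a2)" "y \<noteq> a2"
    using T'(1) unfolding S S1 by auto
  have t: "k1' = k1" "l1' = q * l1" "a2' = q * a2" "y' \<noteq> a1" "Z \<noteq> 1"
     "y' * y * (q * (Z - 1) * k1) = Z * (Z * a1 * k2 + q * l1)"
     "z' * (y' - q * a2) = Z * (y' - a1)" "k2 \<noteq> 0"
     "Z * z1 * ((y - a1) * k2) = q * y * (y - a2) * k1"
    using T' q(1) unfolding S S' S1 by auto
  have "(Z * k2 * z) * (y - a2) = (q * y * k1) * (y - a2)"
    using t(9) z1(2) by algebra
  then have t8: "Z * k2 * z = q * y * k1" using z1(3) by simp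
  have "(f1 * l1) * (Z * (b0 * b1)) = (f1 * l1) * - (sq * f2)"
    using t8 unfolding p(2-5) s using p(7-) by (simp add: field_simps power2_eq_square)
  then have "Z * (b0 * b1) = - (sq * f2)" unfolding mult_cancel_left using p(7-) by auto
  then have Z: "Z = - (sq * f2 / (b0 * b1))" using p(7-) by (simp add: field_simps)
  have n1: "b0 * b1 + sq * f2 \<noteq> 0"
  proof
    assume "b0 * b1 + sq * f2 = 0"
    then have "f2 = - (b0 * b1 / sq)" using p(7-) by (simp add: field_simps eq_neg_iff_add_eq_0)
    then show False using t(5) Z p(7-) by simp
  qed
  have n2: "b0 * f0' + sq \<noteq> 0"
  proof
    assume "b0 * f0' + sq = 0"
    then have "sq = - (b0 * f0')" by (simp add: eq_neg_iff_add_eq_0 add.commute)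
    then show False using t(4) unfolding p(1) p'(4) t(3) s using p(7-) p'(7-)
      by (simp add: field_simps power2_eq_square)
  qed
  have e0: "f0' * f1' * f2' = f0 * f1 * f2"
    using t(1) unfolding p(3) p'(3) t(2,3) s using p p'(7-) by (auto simp: field_simps power2_eq_square)
  have "(a2 * b0 * b1 * f0' * sq) * (f2 * (b0 * f0' + sq))
     = (a2 * b0 * b1 * f0' * sq) * (f1' * (b0 + sq * f0'))"
    using t(7) unfolding p(1-5) p'(4,5) t(2,3) s Z using p(7-) p'(7-)
    by (simp add: field_simps power2_eq_square power3_eq_cube power4_eq_xxxx)
  then have e1: "f2 * (b0 * f0' + sq) = f1' * (b0 + sq * f0')"
    unfolding mult_cancel_left using p(7-) p'(7-) by auto
  have "(a2 ^ 2 * b0 ^ 3 * b1 * f0 * f2 * l1 * sq ^ 3) * (f0' * (sq + b0 * b1 * f2))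
     = (a2 ^ 2 * b0 ^ 3 * b1 * f0 * f2 * l1 * sq ^ 3) * (f1 * (sq * f2 + b0 * b1))"
    using t(6) unfolding p(1-5) p'(3-5) t(2,3) s Z using p(7-) p'(7-)
    by (simp add: field_simps power2_eq_square power3_eq_cube power4_eq_xxxx)
  then have e2: "f0' * (sq + b0 * b1 * f2) = f1 * (sq * f2 + b0 * b1)"
    unfolding mult_cancel_left using p(7-) by auto
  \<comment> \<open>The second denominator of \<open>T0\<close> is a nonzero multiple of this sum;
    through \<open>e2\<close> its nonvanishing comes from \<open>n1\<close>, that is, from
    \<open>Z\<close> being different from 1.\<close>
  have "sq + b0 * b1 * f2 \<noteq> 0"
    using e2 n1 p(10) by (auto simp: add.commute)
  moreover have "b2' + sq * f2 = sq / (b0 * b1) * (sq + b0 * b1 * f2)"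
    using p'(6) p(7,8,15) by (simp add: field_simps)
  ultimately have "b2' + sq * f2 \<noteq> 0" using p(7,8,15) by auto
  moreover have "1 / sq * b0 * f0' + 1 \<noteq> 0"
    using n2 p(15) by (auto simp: field_simps)
  moreover have "f2 * (1 / sq * b0 * f0' + 1) = f1' * (1 / sq * b0 + f0')"
    using e1 p(15) by (simp add: field_simps)
  moreover have "f0' * (b2' + sq * f2) = sq / (b0 * b1) * (f0' * (sq + b0 * b1 * f2))"
    "f1 * (b2' * f2 + sq) = sq / (b0 * b1) * (f1 * (sq * f2 + b0 * b1))"
    using p'(6) p(7,8,15) by (simp_all add: field_simps)
  then have "f0' * (b2' + sq * f2) = f1 * (b2' * f2 + sq)" using e2 by simp
  moreover have "b2' = sq * b2" "b1 = 1 * b1" "b0 = sq * (1 / sq * b0)"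
    using p(6-8,15) p'(6) by auto
  moreover have "f2 * f0 * f1 = f2' * f0' * f1'" using e0 by (simp add: mult_ac)
  moreover have "admissible_sym sq (Sym b2 b0 b1 f2 f0 f1)"
    "admissible_sym sq (Sym b2' (1 / sq * b0) (1 * b1) f2' f0' f1')"
    using corr_I_admissible(2)[OF B] corr_I_admissible(2)[OF B'] by auto
  ultimately show ?thesis
    unfolding T2_iff sigma0.simps using T0_I[OF q(1)] by blast
qed

text \<open>Both squares \<open>b0 ^ 2\<close> and \<open>b1 ^ 2\<close> are fixed, while
  \<open>c ^ 2\<close> is multiplied by \<open>q\<close>. Up to monomial factors the formulas of the
  deformation are ratios of three trinomials, and these are the ones that occur in \<open>w0\<close>
  after \<open>sigma1\<close>.\<close>

lemma T_k1_l2_imp_T3: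
  assumes q: "q \<noteq> 0" "sq ^ 2 = q" and T: "T_k1_l2 q S S'"
    and B: "corr_I q sq S (Sym b0 b1 b2 f0 f1 f2)"
    and B': "corr_I q sq S' (Sym (1 * b0) (1 * b1) b2' f0' f1' f2')"
  shows "T3 sq (Sym b0 b1 b2 f0 f1 f2) (Sym (1 * b0) (1 * b1) b2' f0' f1' f2')"
proof -
  obtain k1 k2 l1 l2 a1 a2 w y z where S: "S = Conn k1 k2 l1 l2 a1 a2 w y z" by (cases S)
  obtain k1' k2' l1' l2' a1' a2' w' y' z' where S': "S' = Conn k1' k2' l1' l2' a1' a2' w' y' z'"
    by (cases S')
  note p = corr_I_parametrization[OF q B[unfolded S]]
  note p' = corr_I_parametrization[OF q B'[unfolded S']]
  have s: "sq = b0 * b1 * b2" "q = b0 * b1 * b2 * (b0 * b1 * b2)" "b2 \<noteq> 0" "b2' = b2"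
    using q p(6-8,15) p'(6) by (auto simp: power2_eq_square)
  \<comment> \<open>Up to monomials, \<open>N\<close> and \<open>D\<close> are the numerator and
    denominator in the equation for \<open>z'\<close>, and \<open>E\<close> is the cofactor that
    appears in \<open>z' - 1\<close>. In the coordinates of (I), \<open>N\<close>, \<open>D\<close>,
    \<open>E\<close> are monomials times \<open>P\<close>, \<open>Q\<close>, \<open>R\<close>, and
    the latter are the trinomials of \<open>w0\<close> at the inverted \<open>f\<close>-variables,
    cleared of denominators.\<close>
  define D where "D = a2 * (z * k2 - q * y * k1) + l1"
  define N where "N = z * a1 * a2 * k2 + (a1 - y) * l1"
  define E where "E = z * k2 - q * k1 * (y - a1)"
  define P where "P = b0 * b1 * f0 * f1 + b0 * f0 + 1"
  define Q where "Q = b1 * b2 * f1 * f2 + b1 * f1 + 1"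
  define R where "R = b2 * b0 * f2 * f0 + b2 * f2 + 1"
  have t: "k1' = q * k1" "l1' = l1" "a2' = a2" "D \<noteq> 0" "z' \<noteq> 1"
     "y' * y * (q * (z' - 1) * k1) = z' * (z * a2 * k2 + l1)"
     "z' * z * (k2 * D) = - (q * k1 * N)"
     "y \<noteq> 0" "y' \<noteq> 0" "z \<noteq> 0" "z' \<noteq> 0" "k1 \<noteq> 0" "k2 \<noteq> 0"
    using T q(1) unfolding S S' D_def N_def by (auto simp: mult.commute)
  \<comment> \<open>\<open>z' - 1\<close> factors, which cancels \<open>z * a2 * k2 + l1\<close> from the equation for \<open>y'\<close>.\<close>
  have "(z' - 1) * (z * k2 * D) = - E * (z * a2 * k2 + l1)"
    using t(7) unfolding D_def N_def E_def by algebra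
  moreover from this have *: "z * a2 * k2 + l1 \<noteq> 0" "E \<noteq> 0" using t by auto
  ultimately have "(q * k1 * (z * a2 * k2 + l1)) * (y' * y * E) = (q * k1 * (z * a2 * k2 + l1)) * N"
    using t(6,7) by algebra
  then have t9: "y' * y * E = N" using * t q by simp
  have D: "D = l1 * Q" unfolding D_def Q_def p(1-5) s using p(7-) s(3)
    by (simp add: field_simps power2_eq_square)
  have N: "N = b0 * a2 * l1 / f0 * P" unfolding N_def P_def p(1-5) s using p(7-) s(3)
    by (simp add: field_simps power2_eq_square)
  have E: "E = b1 * l1 * f1 / a2 * R" unfolding E_def R_def p(1-5) s using p(7-) s(3)
    by (simp add: field_simps power2_eq_square)
  have n: "P \<noteq> 0" "Q \<noteq> 0" "R \<noteq> 0" using * t D N E q by auto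
  have e0: "f0' * f1' * f2' = q * (f0 * f1 * f2)"
    using t(1) unfolding p(3) p'(3) t(2,3) s using p(7-) p'(7-) s(3) by (auto simp: field_simps power2_eq_square)
  have e1: "f0' * P = b0 * b1 * f1 * R"
    using t9 unfolding E N p(4) p'(4) t(3) using p(7-) p'(7-)
    by (simp add: field_simps power2_eq_square)
  have e2: "f1' * Q = b1 * b2 * f2 * P"
    using t(7) unfolding D N p(2,3,5) p'(5) s t(3) using p(7-) p'(7-) s(3)
    by (simp add: field_simps power2_eq_square)
  \<comment> \<open>The equation for \<open>f2'\<close> is forced: it results from dividing the
    product relation \<open>e0\<close> by \<open>e1\<close> and \<open>e2\<close>, with
    \<open>q\<close> as the square of \<open>b0 * b1 * b2\<close>.\<close>
  have "(f1 * f2 * b0 * b1 ^ 2 * b2 * P) * (f2' * R)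
     = (f1 * f2 * b0 * b1 ^ 2 * b2 * P) * (b2 * b0 * f0 * Q)"
    using e0 e1 e2 s(2) by algebra
  then have e3: "f2' * R = b2 * b0 * f0 * Q" using n p(7-) s(3) by simp
  have "b0 * b1 + b0 * (1 / f1) + 1 / f0 * (1 / f1) = P / (f0 * f1)"
    "b1 * b2 + b1 * (1 / f2) + 1 / f1 * (1 / f2) = Q / (f1 * f2)"
    "b2 * b0 + b2 * (1 / f0) + 1 / f2 * (1 / f0) = R / (f2 * f0)"
    unfolding P_def Q_def R_def using p(7-) by (auto simp: field_simps)
  note c = this
  have "f0' = b0 * b1 * (R / (f2 * f0)) / (1 / f2 * (P / (f0 * f1)))"
    "f1' = b1 * b2 * (P / (f0 * f1)) / (1 / f0 * (Q / (f1 * f2)))"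
    "f2' = b2 * b0 * (Q / (f1 * f2)) / (1 / f1 * (R / (f2 * f0)))"
    using e1 e2 e3 n p(7-) by (simp_all add: field_simps)
  then show ?thesis
    using n p(7-) s(4) corr_I_admissible(2)[OF B] corr_I_admissible(2)[OF B']
    unfolding T3_iff sigma1.simps w0.simps c by simp
qed

section \<open>From identities to correspondences under (I)\<close>

text \<open>By \<open>par\<close>, scaling by \<open>s\<close> and \<open>t\<close> matches the root
  choices over \<open>S\<close> with those over \<open>S'\<close>, and \<open>corr_I_exists\<close>
  supplies a point over each choice. Hence \<open>key\<close> only has to treat pairs with matched
  roots; since \<open>s\<close> and \<open>t\<close> are nonzero, the matching can also be read
  backwards from \<open>S'\<close>.\<close>

lemma corresponds_corr_I:
  assumes q: "q \<noteq> 0" "sq ^ 2 = q" and st: "s \<noteq> 0" "t \<noteq> 0"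
    and adm: "\<And>S S'. T S S' \<Longrightarrow> admissible_conn S \<and> admissible_conn S'"
    and par: "\<And>S S' b0 b1. T S S' \<Longrightarrow> roots_I S' (s * b0) (t * b1) \<longleftrightarrow> roots_I S b0 b1"
    and key: "\<And>S S' b0 b1 b2 f0 f1 f2 b2' f0' f1' f2'.
      \<lbrakk>T S S'; corr_I q sq S (Sym b0 b1 b2 f0 f1 f2);
       corr_I q sq S' (Sym (s * b0) (t * b1) b2' f0' f1' f2')\<rbrakk>
      \<Longrightarrow> U (Sym b0 b1 b2 f0 f1 f2) (Sym (s * b0) (t * b1) b2' f0' f1' f2')"
  shows "corresponds (corr_I q sq) T U"
  unfolding corresponds_def
proof (intro allI impI conjI)
  fix S S' B
  assume T: "T S S'" and B: "corr_I q sq S B"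
  obtain b0 b1 b2 f0 f1 f2 where [simp]: "B = Sym b0 b1 b2 f0 f1 f2" by (cases B)
  have "roots_I S b0 b1" using B by (cases S) simp
  then show "\<exists>B'. U B B' \<and> corr_I q sq S' B'"
    using corr_I_exists[OF q, of S' "s * b0" "t * b1"] par[OF T] adm[OF T] key[OF T] B by fastforce
next
  fix S S' B'
  assume T: "T S S'" and B': "corr_I q sq S' B'"
  obtain b0' b1' b2 f0 f1 f2 where *: "B' = Sym b0' b1' b2 f0 f1 f2" by (cases B')
  obtain b0 b1 where b [simp]: "b0' = s * b0" "b1' = t * b1"
    using st by (metis nonzero_mult_div_cancel_left times_divide_eq_right)
  have "roots_I S' (s * b0) (t * b1)" using B' * by (cases S') simp
  then show "\<exists>B. U B B' \<and> corr_I q sq S B"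
    using corr_I_exists[OF q, of S "b0" "b1"] par[OF T] adm[OF T] key[OF T] B' * by fastforce
qed

lemma corresponds_conversep: "corresponds R T U \<Longrightarrow> corresponds R T\<inverse>\<inverse> U\<inverse>\<inverse>"
  unfolding corresponds_def by blast

lemma T_a2_l1_D:
  assumes "T_a2_l1 q S S'"
  shows "admissible_conn S \<and> admissible_conn S' \<and>
    (\<exists>k1 k2 l1 l2 a1 a2 w y z w' y' z'. S = Conn k1 k2 l1 l2 a1 a2 w y z \<and>
      S' = Conn k1 k2 (q * l1) l2 a1 (q * a2) w' y' z')"
proof -
  obtain S1 S1' where "S_a1_a2 S S1" "T_a1_l1 q S1 S1'" "S_a1_a2 S1' S'"
    using assms unfolding T_a2_l1_def by blast
  then show ?thesis by (cases S; cases S1; cases S1'; cases S') auto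
qed

lemma aligned_corr_I:
  assumes q: "q \<noteq> 0" "sq ^ 2 = q"
  shows "aligned (corr_I q sq) [T0 q sq, T1 q sq, T2 q sq, T3 sq]
     [(T_a1_l1 q)\<inverse>\<inverse>, T_k1_l1 q, (T_a2_l1 q)\<inverse>\<inverse>, T_k1_l2 q]"
proof -
  have s: "sq \<noteq> 0" using q by auto
  have up: "(sq * b) ^ 2 = q * x / y \<longleftrightarrow> b ^ 2 = x / y" for b x y
  proof -
    have "(sq * b) ^ 2 = q * b ^ 2" "q * x / y = q * (x / y)"
      using q by (simp_all add: power_mult_distrib)
    then show ?thesis using q(1) by (simp only: mult_cancel_left) simp
  qed
  have down: "(1 / sq * b) ^ 2 = x / (q * y) \<longleftrightarrow> b ^ 2 = x / y" for b x y
  proof -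
    have "(1 / sq * b) ^ 2 = b ^ 2 / q" "x / (q * y) = x / y / q"
      using q by (simp_all add: power_divide)
    then show ?thesis using q(1) by (simp only: divide_cancel_right) simp
  qed
  have roots: "roots_I S' b0' b1' \<longleftrightarrow> roots_I S b0 b1"
    if "S = Conn k1 k2 l1 l2 a1 a2 w y z" "S' = Conn k1' k2' l1' l2' a1' a2' w' y' z'"
      "b0' ^ 2 = a1' / a2' \<longleftrightarrow> b0 ^ 2 = a1 / a2"
      "b1' ^ 2 = - a2' * k2' / l1' \<longleftrightarrow> b1 ^ 2 = - a2 * k2 / l1"
    for S S' b0 b1 b0' b1' k1 k2 l1 l2 a1 a2 w y z k1' k2' l1' l2' a1' a2' w' y' z'
    using that by simp
  \<comment> \<open>For \<open>T_a1_l1\<close>, and likewise for \<open>T_a2_l1\<close>, the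
    explicit forward deformation is matched with the converse of the translation; converses are
    taken at the end.\<close>
  have c0: "corresponds (corr_I q sq) (T_a1_l1 q) (T0 q sq)\<inverse>\<inverse>"
  proof (rule corresponds_corr_I[OF q s])
    show "1 / sq \<noteq> 0" using s by simp
    fix S S' b0 b1 assume T: "T_a1_l1 q S S'"
    show "admissible_conn S \<and> admissible_conn S'" using T by (cases S; cases S') simp
    obtain k1 k2 l1 l2 a1 a2 w y z where S: "S = Conn k1 k2 l1 l2 a1 a2 w y z" by (cases S)
    then obtain w' y' z' where S': "S' = Conn k1 k2 (q * l1) l2 (q * a1) a2 w' y' z'"
      using T by (cases S') auto
    show "roots_I S' (sq * b0) (1 / sq * b1) \<longleftrightarrow> roots_I S b0 b1"
      by (rule roots[OF S S' up down])
  next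
    show "(T0 q sq)\<inverse>\<inverse> (Sym b0 b1 b2 f0 f1 f2) (Sym (sq * b0) (1 / sq * b1) b2' f0' f1' f2')"
      if "T_a1_l1 q S S'" "corr_I q sq S (Sym b0 b1 b2 f0 f1 f2)"
        "corr_I q sq S' (Sym (sq * b0) (1 / sq * b1) b2' f0' f1' f2')"
      for S S' b0 b1 b2 f0 f1 f2 b2' f0' f1' f2'
      using T_a1_l1_imp_T0[OF q that] by blast
  qed
  have c1: "corresponds (corr_I q sq) (T_k1_l1 q) (T1 q sq)"
  proof (rule corresponds_corr_I[OF q one_neq_zero])
    show "1 / sq \<noteq> 0" using s by simp
    fix S S' b0 b1 assume T: "T_k1_l1 q S S'"
    show "admissible_conn S \<and> admissible_conn S'" using T by (cases S; cases S') simp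
    obtain k1 k2 l1 l2 a1 a2 w y z where S: "S = Conn k1 k2 l1 l2 a1 a2 w y z" by (cases S)
    then obtain w' y' z' where S': "S' = Conn (q * k1) k2 (q * l1) l2 a1 a2 w' y' z'"
      using T by (cases S') auto
    show "roots_I S' (1 * b0) (1 / sq * b1) \<longleftrightarrow> roots_I S b0 b1"
      by (rule roots[OF S S' _ down]) simp
  next
    show "T1 q sq (Sym b0 b1 b2 f0 f1 f2) (Sym (1 * b0) (1 / sq * b1) b2' f0' f1' f2')"
      if "T_k1_l1 q S S'" "corr_I q sq S (Sym b0 b1 b2 f0 f1 f2)"
        "corr_I q sq S' (Sym (1 * b0) (1 / sq * b1) b2' f0' f1' f2')"
      for S S' b0 b1 b2 f0 f1 f2 b2' f0' f1' f2'
      using T_k1_l1_imp_T1[OF q that] .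
  qed
  have c2: "corresponds (corr_I q sq) (T_a2_l1 q) (T2 q sq)\<inverse>\<inverse>"
  proof (rule corresponds_corr_I[OF q _ one_neq_zero])
    show "1 / sq \<noteq> 0" using s by simp
    fix S S' b0 b1 assume T: "T_a2_l1 q S S'"
    show "admissible_conn S \<and> admissible_conn S'" using T_a2_l1_D[OF T] by blast
    obtain k1 k2 l1 l2 a1 a2 w y z w' y' z' where S: "S = Conn k1 k2 l1 l2 a1 a2 w y z"
      and S': "S' = Conn k1 k2 (q * l1) l2 a1 (q * a2) w' y' z'"
      using T_a2_l1_D[OF T] by blast
    have "- (q * a2) * k2 / (q * l1) = - a2 * k2 / l1" using q(1) by simp
    then show "roots_I S' (1 / sq * b0) (1 * b1) \<longleftrightarrow> roots_I S b0 b1"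
      by (intro roots[OF S S' down]) simp
  next
    show "(T2 q sq)\<inverse>\<inverse> (Sym b0 b1 b2 f0 f1 f2) (Sym (1 / sq * b0) (1 * b1) b2' f0' f1' f2')"
      if "T_a2_l1 q S S'" "corr_I q sq S (Sym b0 b1 b2 f0 f1 f2)"
        "corr_I q sq S' (Sym (1 / sq * b0) (1 * b1) b2' f0' f1' f2')"
      for S S' b0 b1 b2 f0 f1 f2 b2' f0' f1' f2'
      using T_a2_l1_imp_T2[OF q that] by blast
  qed
  have c3: "corresponds (corr_I q sq) (T_k1_l2 q) (T3 sq)"
  proof (rule corresponds_corr_I[OF q one_neq_zero one_neq_zero])
    fix S S' b0 b1 assume T: "T_k1_l2 q S S'"
    show "admissible_conn S \<and> admissible_conn S'" using T by (cases S; cases S') simp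
    show "roots_I S' (1 * b0) (1 * b1) \<longleftrightarrow> roots_I S b0 b1"
      using T by (cases S; cases S') auto
  next
    show "T3 sq (Sym b0 b1 b2 f0 f1 f2) (Sym (1 * b0) (1 * b1) b2' f0' f1' f2')"
      if "T_k1_l2 q S S'" "corr_I q sq S (Sym b0 b1 b2 f0 f1 f2)"
        "corr_I q sq S' (Sym (1 * b0) (1 * b1) b2' f0' f1' f2')"
      for S S' b0 b1 b2 f0 f1 f2 b2' f0' f1' f2'
      using T_k1_l2_imp_T3[OF q that] .
  qed
  show ?thesis
    using c1 c3 corresponds_conversep[OF c0] corresponds_conversep[OF c2] by (simp add: aligned_def)
qed

lemma change_of_variables_corr_I:
  assumes q: "q \<noteq> 0" "sq ^ 2 = q"
  shows "change_of_variables sq (corr_I q sq)"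
  unfolding change_of_variables_def
proof (intro conjI allI impI)
  fix S assume S: "admissible_conn S"
  obtain k1 k2 l1 l2 a1 a2 w y z where "S = Conn k1 k2 l1 l2 a1 a2 w y z" by (cases S)
  then have "roots_I S (csqrt (a1 / a2)) (csqrt (- a2 * k2 / l1))" by simp
  then show "\<exists>B. corr_I q sq S B" using corr_I_exists[OF q S] by blast
next
  fix B assume B: "admissible_sym sq B"
  obtain b0 b1 b2 f0 f1 f2 where [simp]: "B = Sym b0 b1 b2 f0 f1 f2" by (cases B)
  have s: "sq \<noteq> 0" "q = sq * sq" using q by (auto simp: power2_eq_square)
  \<comment> \<open>The witness is the parametrization of (I) with the free values
    \<open>l1\<close>, \<open>a2\<close>, \<open>w\<close> set to 1; \<open>l2\<close> is then
    dictated by \<open>k1 * k2 * a1 * a2 = l1 * l2\<close>.\<close>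
  have "corr_I q sq (Conn (f0 * f1 * f2 / (sq * b0 ^ 2)) (- (b1 ^ 2)) 1 (- (f0 * f1 * f2 * b1 ^ 2 / sq))
      (b0 ^ 2) 1 1 (- (b0 / f0)) (- (f1 / b1))) B"
    using B s(1) unfolding s(2) by (auto simp: power2_eq_square field_simps)
  then show "\<exists>S. corr_I q sq S B" by blast
qed

section \<open>Transport along the diagram automorphisms\<close>

lemma change_of_variables_transfer:
  assumes "change_of_variables sq R" "\<And>S B. R' S B \<longleftrightarrow> R S (h B)" "\<And>B. h (k B) = B"
    "\<And>B. admissible_sym sq B \<Longrightarrow> admissible_sym sq (h B)"
  shows "change_of_variables sq R'"
  using assms unfolding change_of_variables_def by metis

text \<open>The section \<open>k\<close> makes \<open>h\<close> surjective, so every point that the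
  correspondence for \<open>R\<close> produces has the form \<open>h B\<close> and gives a point for
  \<open>R'\<close>.\<close>

lemma corresponds_transfer:
  assumes "corresponds R T U" "\<And>S B. R' S B \<longleftrightarrow> R S (h B)" "\<And>B. h (k B) = B"
    "\<And>B B'. U' B B' \<longleftrightarrow> U (h B) (h B')"
  shows "corresponds R' T U'"
  using assms unfolding corresponds_def by (metis (full_types))

lemma sigma0_cube: "sigma0 (sigma0 (sigma0 B)) = B"
  by (cases B) simp

lemma sigma1_involution: "sigma1 (sigma1 B) = B"
  by (cases B) simp

lemma sigma0_sigma1: "sigma0 (sigma1 B) = sigma1 (sigma0 B)"
  by (cases B) simp

lemma w0_sigma0: "w0 sq (sigma0 B) (sigma0 B') \<longleftrightarrow> w0 sq B B'"
  by (cases B; cases B') (auto simp: mult_ac)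

text \<open>At the image point the trinomials \<open>P\<close>, \<open>Q\<close>, \<open>R\<close>
  take values that are monomials times the old \<open>R\<close>, \<open>P\<close>, \<open>Q\<close>.
  Inserting these in the formulas of \<open>w0\<close> returns the original
  \<open>f\<close>-variables.\<close>

lemma w0_sym:
  assumes "w0 sq B B'" shows "w0 sq B' B"
proof -
  obtain b0 b1 b2 f0 f1 f2 where B: "B = Sym b0 b1 b2 f0 f1 f2" by (cases B)
  obtain f0' f1' f2' where B': "B' = Sym b0 b1 b2 f0' f1' f2'"
    using assms unfolding B by (cases B') auto
  define P where "P = b0 * b1 + b0 * f1 + f0 * f1"
  define Q where "Q = b1 * b2 + b1 * f2 + f1 * f2"
  define R where "R = b2 * b0 + b2 * f0 + f2 * f0"
  have n: "P \<noteq> 0" "Q \<noteq> 0" "R \<noteq> 0" "b0 \<noteq> 0" "b1 \<noteq> 0" "b2 \<noteq> 0" "f0 \<noteq> 0" "f1 \<noteq> 0" "f2 \<noteq> 0"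
    and f: "f0' = b0 * b1 * R / (f2 * P)" "f1' = b1 * b2 * P / (f0 * Q)" "f2' = b2 * b0 * Q / (f1 * R)"
    using assms unfolding B B' P_def Q_def R_def by auto
  \<comment> \<open>These are the equations \<open>c\<close> after the new
    \<open>f\<close>-variables are substituted and denominators are cleared.\<close>
  have "b0 * b1 * (f0 * f2 * Q + b2 * f2 * P + b1 * b2 * R) = b0 * b1 * (Q * R)"
    "b1 * b2 * (f1 * f0 * R + b0 * f0 * Q + b2 * b0 * P) = b1 * b2 * (R * P)"
    "b2 * b0 * (f2 * f1 * P + b1 * f1 * R + b0 * b1 * Q) = b2 * b0 * (P * Q)"
    unfolding P_def Q_def R_def by algebra+
  then have c: "b0 * b1 + b0 * f1' + f0' * f1' = b0 * b1 * R / (f0 * f2)"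
    "b1 * b2 + b1 * f2' + f1' * f2' = b1 * b2 * P / (f1 * f0)"
    "b2 * b0 + b2 * f0' + f2' * f0' = b2 * b0 * Q / (f2 * f1)"
    unfolding f using n by (simp_all add: field_simps)
  have "f0 = b0 * b1 * (b2 * b0 * Q / (f2 * f1)) / (f2' * (b0 * b1 * R / (f0 * f2)))"
    "f1 = b1 * b2 * (b0 * b1 * R / (f0 * f2)) / (f0' * (b1 * b2 * P / (f1 * f0)))"
    "f2 = b2 * b0 * (b1 * b2 * P / (f1 * f0)) / (f1' * (b2 * b0 * Q / (f2 * f1)))"
    unfolding f using n by (simp_all add: field_simps)
  moreover have "admissible_sym sq B" "admissible_sym sq B'"
    using assms unfolding B B' by auto
  ultimately show ?thesis using n unfolding B B' w0.simps c
    by simp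
qed

lemma T3_sigma0: "T3 sq (sigma0 B) (sigma0 B') \<longleftrightarrow> T3 sq B B'"
  by (simp add: T3_iff w0_sigma0 flip: sigma0_sigma1)

text \<open>Conjugating a product of the two involutions \<open>sigma1\<close> and \<open>w0\<close>
  by \<open>sigma1\<close> reverses their order, which gives the inverse. This is the source of the
  inverse of \<open>T_k1_l2\<close> in the alignments that invert \<open>c\<close>.\<close>

lemma T3_sigma1: "T3 sq (sigma1 B) (sigma1 B') \<longleftrightarrow> T3 sq B' B"
  using w0_sym by (auto simp: T3_iff sigma1_involution)

text \<open>Inverting the \<open>f\<close>-variables interchanges, up to a monomial, numerator and
  denominator in each equation of \<open>T0\<close>, together with the variables multiplying them.
  So each of the cleared equations \<open>e1\<close>, \<open>e2\<close> is mapped to itself.\<close>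

lemma T0_sigma1_imp:
  assumes "q \<noteq> 0" "T0 q sq B B'"
  shows "T0 q sq (sigma1 B) (sigma1 B')"
proof -
  obtain b0 b1 b2 f0 f1 f2 where B: "B = Sym b0 b1 b2 f0 f1 f2" by (cases B)
  obtain b0' b1' b2' f0' f1' f2' where B': "B' = Sym b0' b1' b2' f0' f1' f2'" by (cases B')
  have n: "f0 \<noteq> 0" "f1 \<noteq> 0" "f2 \<noteq> 0" "f0' \<noteq> 0" "f1' \<noteq> 0" "f2' \<noteq> 0" "sq \<noteq> 0"
    and d: "b1 * f1 + 1 \<noteq> 0" "b0 + sq * f0' \<noteq> 0"
    and b: "b0 = sq * b0'" "b1' = sq * b1" "b2' = b2"
    and e0: "f0' * f1' * f2' = f0 * f1 * f2"
    and t: "f0' * f0 = f0 * f1 * f2 * (b1 + f1) / (f1 * (b1 * f1 + 1))"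
      "f1' * f1 = f0 * f1 * f2 * (b0 * f0' + sq) / (f0' * (b0 + sq * f0'))"
    using assms unfolding B B' by (auto simp: Let_def)
  have "f0 * f1 * (f0' * (b1 * f1 + 1)) = f0 * f1 * (f2 * (b1 + f1))"
    using t(1) n d by (simp add: eq_divide_eq mult_ac)
  then have e1: "f0' * (b1 * f1 + 1) = f2 * (b1 + f1)" using n by simp
  have "f1' * f0' * (f1 * (b0 + sq * f0')) = f0 * f1 * f2 * (b0 * f0' + sq)"
    using t(2) n d by (simp add: eq_divide_eq mult_ac)
  then have "f1' * f0' * (f1 * (b0 + sq * f0')) = f1' * f0' * (f2' * (b0 * f0' + sq))"
    unfolding e0[symmetric] by (simp add: mult_ac)
  then have e2: "f1 * (b0 + sq * f0') = f2' * (b0 * f0' + sq)" using n by simp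
  \<comment> \<open>The old numerators become the denominators at the inverted points, so they must
    be nonzero; the cleared equations transfer this from the old denominators.\<close>
  have d': "b1 + f1 \<noteq> 0" "b0 * f0' + sq \<noteq> 0" using e1 e2 n d by auto
  have c: "b1 * (1 / f1) + 1 = (b1 + f1) / f1" "b1 + 1 / f1 = (b1 * f1 + 1) / f1"
    "b0 + sq * (1 / f0') = (b0 * f0' + sq) / f0'" "b0 * (1 / f0') + sq = (b0 + sq * f0') / f0'"
    using n by (simp_all add: field_simps)
  have adm: "admissible_sym sq (sigma1 B)" "admissible_sym sq (sigma1 B')"
    using assms(2) unfolding B B' by auto
  have "1 / f0' * (1 / f1') * (1 / f2') = 1 / f0 * (1 / f1) * (1 / f2)" using e0 by simp
  moreover have "1 / f0' * ((b1 + f1) / f1) = 1 / f2 * ((b1 * f1 + 1) / f1)"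
    using e1 n by (simp add: frac_eq_eq mult_ac)
  moreover have "1 / f1 * ((b0 * f0' + sq) / f0') = 1 / f2' * ((b0 + sq * f0') / f0')"
    using e2 n by (simp add: frac_eq_eq mult_ac)
  moreover have "b1 * (1 / f1) + 1 \<noteq> 0" "b0 + sq * (1 / f0') \<noteq> 0"
    unfolding c using d' n by auto
  ultimately show ?thesis using T0_I[OF assms(1) adm[unfolded B B' sigma1.simps] b]
    unfolding B B' sigma1.simps c by blast
qed

lemma T0_sigma1:
  assumes "q \<noteq> 0"
  shows "T0 q sq (sigma1 B) (sigma1 B') \<longleftrightarrow> T0 q sq B B'"
  using T0_sigma1_imp[OF assms] sigma1_involution by metis

text \<open>Seen through \<open>sigma0\<close>, the translation \<open>T0\<close> turns into
  \<open>T2\<close>, \<open>T1\<close> into \<open>T0\<close> and \<open>T2\<close> into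
  \<open>T1\<close>, while \<open>T3\<close> is unchanged. This rotates the first three entries of
  the list.\<close>

lemma aligned_sigma0:
  assumes a: "aligned R [T0 q sq, T1 q sq, T2 q sq, T3 sq] [A, B, C, D]"
    and R: "\<And>S B. R' S B \<longleftrightarrow> R S (sigma0 B)"
  shows "aligned R' [T0 q sq, T1 q sq, T2 q sq, T3 sq] [B, C, A, D]"
proof -
  note tr = corresponds_transfer[where h = sigma0 and k = "\<lambda>B. sigma0 (sigma0 B)" and R = R and R' = R',
      OF _ R sigma0_cube]
  have "corresponds R A (T0 q sq)" "corresponds R B (T1 q sq)"
    "corresponds R C (T2 q sq)" "corresponds R D (T3 sq)"
    using a by (simp_all add: aligned_def)
  then have "corresponds R' A (T2 q sq)" "corresponds R' B (T0 q sq)"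
    "corresponds R' C (T1 q sq)" "corresponds R' D (T3 sq)"
    by (auto elim!: tr simp: T1_iff T2_iff T3_sigma0 sigma0_cube)
  then show ?thesis by (simp add: aligned_def)
qed

lemma aligned_sigma1:
  assumes q: "q \<noteq> 0" and a: "aligned R [T0 q sq, T1 q sq, T2 q sq, T3 sq] [A, B, C, D]"
    and R: "\<And>S B. R' S B \<longleftrightarrow> R S (sigma1 B)"
  shows "aligned R' [T0 q sq, T1 q sq, T2 q sq, T3 sq] [A, B, C, D\<inverse>\<inverse>]"
proof -
  note tr = corresponds_transfer[where h = sigma1 and k = sigma1 and R = R and R' = R',
      OF _ R sigma1_involution]
  have "corresponds R A (T0 q sq)" "corresponds R B (T1 q sq)"
    "corresponds R C (T2 q sq)" "corresponds R D (T3 sq)"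
    using a by (simp_all add: aligned_def)
  then have "corresponds R' A (T0 q sq)" "corresponds R' B (T1 q sq)" "corresponds R' C (T2 q sq)"
    and D: "corresponds R' D (T3 sq)\<inverse>\<inverse>"
    by (auto elim!: tr simp: T1_iff T2_iff T3_sigma1 T0_sigma1[OF q] sigma0_sigma1)
  moreover have "corresponds R' D\<inverse>\<inverse> (T3 sq)"
    using corresponds_conversep[OF D] by simp
  ultimately show ?thesis by (simp add: aligned_def)
qed

section \<open>The other changes of variables as (I) after an automorphism\<close>

lemma admissible_symD:
  assumes "q \<noteq> 0" "sq ^ 2 = q" "admissible_sym sq (Sym b0 b1 b2 f0 f1 f2)"
  shows "b0 \<noteq> 0" "b1 \<noteq> 0" "b2 \<noteq> 0" "f0 \<noteq> 0" "f1 \<noteq> 0" "f2 \<noteq> 0"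
    "sq = b0 * b1 * b2" "q = b0 ^ 2 * b1 ^ 2 * b2 ^ 2"
  using assms by (auto simp: power_mult_distrib)

text \<open>The product \<open>f0 * f1 * f2\<close> in \<open>c ^ 2\<close> reduces the formula for
  \<open>y\<close> to one in \<open>b2\<close> and \<open>f2\<close>, and
  \<open>b0 * b1 * b2 = sq\<close> trades the condition on \<open>b1\<close> for one on
  \<open>b2\<close>, given the one on \<open>b0\<close>.\<close>

lemma corr_II_iff:
  assumes q: "q \<noteq> 0" "sq ^ 2 = q"
  shows "corr_II q sq S B \<longleftrightarrow> corr_I q sq S (sigma0 B)"
proof -
  obtain b0 b1 b2 f0 f1 f2 where B: "B = Sym b0 b1 b2 f0 f1 f2" by (cases B)
  obtain k1 k2 l1 l2 a1 a2 w y z where S: "S = Conn k1 k2 l1 l2 a1 a2 w y z" by (cases S)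
  show ?thesis
  proof (cases "admissible_sym sq B \<and> admissible_conn S")
    case False
    then show ?thesis unfolding B S by auto
  next
    case True
    note n = admissible_symD[OF q, of b0 b1 b2 f0 f1 f2, OF True[THEN conjunct1, unfolded B]]
    have S0: "a1 \<noteq> 0" "a2 \<noteq> 0" "k1 \<noteq> 0" "k2 \<noteq> 0" "l1 \<noteq> 0" using True unfolding S by auto
    have "f0 * f1 * f2 / q * (q * sq) = f0 * f1 * f2 * (b0 * b1 * b2)"
      using q(1) unfolding n(7)[symmetric] by simp
    then have y: "- a1 * b0 * b1 * f0 * f1 / (f0 * f1 * f2 / q * (q * sq)) = - a1 / (b2 * f2)"
      using n(1-6) by simp
    have "b1 ^ 2 = - q * l1 / (a1 * k2) \<longleftrightarrow> b2 ^ 2 = a1 / a2" if b: "b0 ^ 2 = - a2 * k2 / l1"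
    proof -
      have ql: "q * l1 = - (b1 ^ 2 * (k2 * (a2 * b2 ^ 2)))"
        unfolding n(8) b using S0 by simp
      have "b1 ^ 2 = - q * l1 / (a1 * k2) \<longleftrightarrow> b1 ^ 2 * (k2 * a1) = - (q * l1)"
        unfolding eq_divide_eq using S0 by (simp add: mult_ac)
      also have "\<dots> \<longleftrightarrow> a1 = a2 * b2 ^ 2"
        unfolding ql minus_minus mult_cancel_left using n(2) S0 by simp
      finally show ?thesis using S0 by (auto simp: eq_divide_eq mult.commute)
    qed
    moreover have c: "f2 * f0 * f1 = f0 * f1 * f2" by simp
    moreover have "admissible_sym sq (sigma0 B)" using True unfolding B by auto
    ultimately show ?thesis using True
      unfolding B S corr_II.simps corr_I.simps sigma0.simps c_squared.simps y c by blast
  qed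
qed

text \<open>The formulas for \<open>y\<close>, \<open>z\<close> and \<open>b0 ^ 2\<close> agree with
  the shifted ones of (I) only modulo the other equations, so each is compared under those as
  assumptions: \<open>y\<close> and \<open>b0 ^ 2\<close> given \<open>b1 ^ 2\<close>, and
  \<open>z\<close> given \<open>c ^ 2\<close> and \<open>b2 ^ 2\<close>.\<close>

lemma corr_III_iff:
  assumes q: "q \<noteq> 0" "sq ^ 2 = q"
  shows "corr_III q sq S B \<longleftrightarrow> corr_I q sq S (sigma0 (sigma0 B))"
proof -
  obtain b0 b1 b2 f0 f1 f2 where B: "B = Sym b0 b1 b2 f0 f1 f2" by (cases B)
  obtain k1 k2 l1 l2 a1 a2 w y z where S: "S = Conn k1 k2 l1 l2 a1 a2 w y z" by (cases S)
  show ?thesis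
  proof (cases "admissible_sym sq B \<and> admissible_conn S")
    case False
    then show ?thesis unfolding B S by auto
  next
    case True
    note n = admissible_symD[OF q, of b0 b1 b2 f0 f1 f2, OF True[THEN conjunct1, unfolded B]]
    have S0: "a1 \<noteq> 0" "a2 \<noteq> 0" "k1 \<noteq> 0" "k2 \<noteq> 0" "l1 \<noteq> 0" using True unfolding S by auto
    have y: "- a2 * b1 / f1 = - a1 / (b1 * f1)" if b: "b1 ^ 2 = a1 / a2"
    proof -
      have "a1 = a2 * b1 ^ 2" using b S0 by simp
      then show ?thesis using n(2) by (simp add: power2_eq_square)
    qed
    have b: "b0 ^ 2 = - q * l1 / (a1 * k2) \<longleftrightarrow> b2 ^ 2 = - a2 * k2 / l1" if b: "b1 ^ 2 = a1 / a2"
    proof -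
      have "b0 ^ 2 = - q * l1 / (a1 * k2) \<longleftrightarrow> b0 ^ 2 * (a2 * k2) = b0 ^ 2 * (- l1 * b2 ^ 2)"
        unfolding n(8) b using S0 by (simp add: eq_divide_eq) (simp add: field_simps)
      also have "\<dots> \<longleftrightarrow> a2 * k2 = - l1 * b2 ^ 2" unfolding mult_cancel_left using n(1) by simp
      finally show ?thesis using S0 by (auto simp: eq_divide_eq mult.commute)
    qed
    have z: "q * a1 * k1 / (b0 * b1 * f0 * f1 * k2) = - f2 / b2"
      if c: "f0 * f1 * f2 / q = a1 * a2 * k1 / (sq * l1)" and b: "b2 ^ 2 = - a2 * k2 / l1"
    proof -
      have "a2 * k2 = - (b2 ^ 2 * l1)" using b S0 by simp
      moreover have "sq * (f0 * f1 * f2 * l1) = q * a1 * a2 * k1"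
        using c q n(7,1,2,3) S0 by (simp add: frac_eq_eq mult_ac)
      \<comment> \<open>The extra factor \<open>a2\<close> allows the relation for
        \<open>b2 ^ 2\<close> to enter in the polynomial form
        \<open>a2 * k2 = - (b2 ^ 2 * l1)\<close>.\<close>
      ultimately have "a2 * (q * a1 * k1 * b2) = a2 * (- f2 * (b0 * b1 * f0 * f1 * k2))"
        unfolding n(7) by algebra
      then have "q * a1 * k1 * b2 = - f2 * (b0 * b1 * f0 * f1 * k2)"
        unfolding mult_cancel_left using S0 by simp
      then show ?thesis using n(1-6) S0 by (subst frac_eq_eq) simp_all
    qed
    moreover have c: "f1 * f2 * f0 = f0 * f1 * f2" by simp
    moreover have adm: "admissible_sym sq (sigma0 (sigma0 B))" using True unfolding B by auto
    ultimately have "b1 ^ 2 = a1 / a2 \<Longrightarrow> y = - a2 * b1 / f1 \<longleftrightarrow> y = - a1 / (b1 * f1)"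
      "f0 * f1 * f2 / q = a1 * a2 * k1 / (sq * l1) \<Longrightarrow> b2 ^ 2 = - a2 * k2 / l1 \<Longrightarrow>
        z = q * a1 * k1 / (b0 * b1 * f0 * f1 * k2) \<longleftrightarrow> z = - f2 / b2"
      using y by simp_all
    then show ?thesis using True adm b
      unfolding B S corr_III.simps corr_I.simps sigma0.simps c_squared.simps c by blast
  qed
qed

text \<open>The prescription of \<open>c ^ 2\<close> in the unprimed changes of variables, read at
  inverted \<open>f\<close>-variables, becomes that of the primed ones; the power of
  \<open>q\<close> is adjusted by \<open>q = sq * sq\<close>.\<close>

lemma inverted_c_iff:
  fixes q :: complex
  assumes "q \<noteq> 0" "sq ^ 2 = q" "f0 \<noteq> 0" "f1 \<noteq> 0" "f2 \<noteq> 0" "k1 \<noteq> 0" "l1 \<noteq> 0" "a1 \<noteq> 0" "a2 \<noteq> 0"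
  shows "1 / f0 * (1 / f1) * (1 / f2) / q = a1 * a2 * k1 / (sq * l1) \<longleftrightarrow>
    f0 * f1 * f2 / q = l1 / (q * sq * a1 * a2 * k1)"
proof -
  have "sq \<noteq> 0" "q = sq * sq" using assms by (auto simp: power2_eq_square)
  then show ?thesis using assms(3-) by (auto simp: frac_eq_eq)
qed

lemma admissible_sym_sigma1: "admissible_sym sq (sigma1 B) \<longleftrightarrow> admissible_sym sq B"
  by (cases B) auto

lemma corr_I'_iff:
  assumes q: "q \<noteq> 0" "sq ^ 2 = q"
  shows "corr_I' q sq S B \<longleftrightarrow> corr_I q sq S (sigma1 B)"
proof -
  obtain b0 b1 b2 f0 f1 f2 where B: "B = Sym b0 b1 b2 f0 f1 f2" by (cases B)
  obtain k1 k2 l1 l2 a1 a2 w y z where S: "S = Conn k1 k2 l1 l2 a1 a2 w y z" by (cases S)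
  show ?thesis
  proof (cases "admissible_sym sq B \<and> admissible_conn S")
    case False
    then show ?thesis unfolding B S by auto
  next
    case True
    note n = admissible_symD[OF q, of b0 b1 b2 f0 f1 f2, OF True[THEN conjunct1, unfolded B]]
    have S0: "a1 \<noteq> 0" "a2 \<noteq> 0" "k1 \<noteq> 0" "l1 \<noteq> 0" using True unfolding S by auto
    have "y = - a2 * b0 * f0 \<longleftrightarrow> y = - a1 / (b0 * (1 / f0))" if b: "b0 ^ 2 = a1 / a2"
    proof -
      have "a1 = a2 * b0 ^ 2" using b S0 by simp
      then show ?thesis using n(1) by (simp add: power2_eq_square mult_ac)
    qed
    moreover have "z = - 1 / (b1 * f1) \<longleftrightarrow> z = - (1 / f1) / b1" by (simp add: mult.commute)
    moreover have "admissible_sym sq (sigma1 B)" using True admissible_sym_sigma1 by simp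
    moreover note inverted_c_iff[OF q n(4-6) S0(3,4,1,2)]
    ultimately show ?thesis using True
      unfolding B S corr_I'.simps corr_I.simps sigma1.simps c_squared.simps by blast
  qed
qed

lemma corr_II'_iff:
  assumes q: "q \<noteq> 0" "sq ^ 2 = q"
  shows "corr_II' q sq S B \<longleftrightarrow> corr_II q sq S (sigma1 B)"
proof -
  obtain b0 b1 b2 f0 f1 f2 where B: "B = Sym b0 b1 b2 f0 f1 f2" by (cases B)
  obtain k1 k2 l1 l2 a1 a2 w y z where S: "S = Conn k1 k2 l1 l2 a1 a2 w y z" by (cases S)
  show ?thesis
  proof (cases "admissible_sym sq B \<and> admissible_conn S")
    case False
    then show ?thesis unfolding B S by auto
  next
    case True
    note n = admissible_symD[OF q, of b0 b1 b2 f0 f1 f2, OF True[THEN conjunct1, unfolded B]]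
    have S0: "a1 \<noteq> 0" "a2 \<noteq> 0" "k1 \<noteq> 0" "l1 \<noteq> 0" using True unfolding S by auto
    have "sq \<noteq> 0" "q = sq * sq" using q by (auto simp: power2_eq_square)
    then have "y = - a1 * b0 * b1 * (f0 * f1 * f2 / q) * sq / (f0 * f1) \<longleftrightarrow>
      y = - a1 * b0 * b1 * (1 / f0) * (1 / f1) / (1 / f0 * (1 / f1) * (1 / f2) / q * (q * sq))"
      using n(1-6) by simp
    moreover have "z = - 1 / (b0 * f0) \<longleftrightarrow> z = - (1 / f0) / b0" by (simp add: mult.commute)
    moreover have "admissible_sym sq (sigma1 B)" using True admissible_sym_sigma1 by simp
    moreover note inverted_c_iff[OF q n(4-6) S0(3,4,1,2)]
    ultimately show ?thesis using True
      unfolding B S corr_II'.simps corr_II.simps sigma1.simps c_squared.simps by blast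
  qed
qed

lemma corr_III'_iff:
  assumes q: "q \<noteq> 0" "sq ^ 2 = q"
  shows "corr_III' q sq S B \<longleftrightarrow> corr_III q sq S (sigma1 B)"
proof -
  obtain b0 b1 b2 f0 f1 f2 where B: "B = Sym b0 b1 b2 f0 f1 f2" by (cases B)
  obtain k1 k2 l1 l2 a1 a2 w y z where S: "S = Conn k1 k2 l1 l2 a1 a2 w y z" by (cases S)
  show ?thesis
  proof (cases "admissible_sym sq B \<and> admissible_conn S")
    case False
    then show ?thesis unfolding B S by auto
  next
    case True
    note n = admissible_symD[OF q, of b0 b1 b2 f0 f1 f2, OF True[THEN conjunct1, unfolded B]]
    have S0: "a1 \<noteq> 0" "a2 \<noteq> 0" "k1 \<noteq> 0" "l1 \<noteq> 0" using True unfolding S by auto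
    have "y = - a2 * b1 * f1 \<longleftrightarrow> y = - a2 * b1 / (1 / f1)" by simp
    moreover have "z = q * a1 * k1 * f0 * f1 / (b0 * b1 * k2) \<longleftrightarrow>
      z = q * a1 * k1 / (b0 * b1 * (1 / f0) * (1 / f1) * k2)"
      using n(4,5) by (simp add: mult_ac)
    moreover have "admissible_sym sq (sigma1 B)" using True admissible_sym_sigma1 by simp
    moreover note inverted_c_iff[OF q n(4-6) S0(3,4,1,2)]
    ultimately show ?thesis using True
      unfolding B S corr_III'.simps corr_III.simps sigma1.simps c_squared.simps by blast
  qed
qed

section \<open>Comparison of correspondences and assembly\<close>

text \<open>Two points over the same \<open>S\<close> can differ only through the choice of roots.
  Applied to \<open>sigma0 B\<close> or \<open>sigma1 B\<close> in place of one of the points, this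
  yields the formulas for changing between correspondences.\<close>

lemma corr_I_f_eq:
  assumes "q \<noteq> 0" "sq ^ 2 = q"
    and "corr_I q sq S (Sym b0 b1 b2 f0 f1 f2)" "corr_I q sq S (Sym b0' b1' b2' f0' f1' f2')"
  shows "b0' = b0 \<Longrightarrow> f0' = f0" "b1' = b1 \<Longrightarrow> f1' = f1"
    "b0' ^ 2 = b0 ^ 2" "b1' ^ 2 = b1 ^ 2" "b2' ^ 2 = b2 ^ 2"
    "c_squared q (Sym b0' b1' b2' f0' f1' f2') = c_squared q (Sym b0 b1 b2 f0 f1 f2)"
proof -
  obtain k1 k2 l1 l2 a1 a2 w y z where S: "S = Conn k1 k2 l1 l2 a1 a2 w y z" by (cases S)
  note e = assms(3,4)[unfolded S corr_I_iff[OF assms(1,2)]]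
  show "b0' = b0 \<Longrightarrow> f0' = f0" "b1' = b1 \<Longrightarrow> f1' = f1" using e by blast+
  show b: "b0' ^ 2 = b0 ^ 2" "b1' ^ 2 = b1 ^ 2" using e by auto
  show "b2' ^ 2 = b2 ^ 2" using e b by (simp add: power_divide power_mult_distrib)
  show "c_squared q (Sym b0' b1' b2' f0' f1' f2') = c_squared q (Sym b0 b1 b2 f0 f1 f2)"
    using assms(3,4) unfolding S by simp
qed

theorem mainTheorem2:
  fixes q sq :: complex
  assumes q: "q \<noteq> 0" "norm q \<noteq> 1" and sq: "sq ^ 2 = q"
  shows
    "change_of_variables sq (corr_I q sq) \<and> change_of_variables sq (corr_I' q sq) \<and>
     change_of_variables sq (corr_II q sq) \<and> change_of_variables sq (corr_II' q sq) \<and>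
     change_of_variables sq (corr_III q sq) \<and> change_of_variables sq (corr_III' q sq) \<and>
     corresponds (corr_I q sq) (T_a1_l1 q)\<inverse>\<inverse> (T0 q sq) \<and>
     corresponds (corr_II q sq) (T_k1_l1 q) (T0 q sq) \<and>
     corresponds (corr_III q sq) (T_a2_l1 q)\<inverse>\<inverse> (T0 q sq) \<and>
     corresponds (corr_I' q sq) (T_a1_l1 q)\<inverse>\<inverse> (T0 q sq) \<and>
     corresponds (corr_II' q sq) (T_k1_l1 q) (T0 q sq) \<and>
     corresponds (corr_III' q sq) (T_a2_l1 q)\<inverse>\<inverse> (T0 q sq) \<and>
     aligned (corr_I q sq) [T0 q sq, T1 q sq, T2 q sq, T3 sq]
       [(T_a1_l1 q)\<inverse>\<inverse>, T_k1_l1 q, (T_a2_l1 q)\<inverse>\<inverse>, T_k1_l2 q] \<and>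
     aligned (corr_II q sq) [T0 q sq, T1 q sq, T2 q sq, T3 sq]
       [T_k1_l1 q, (T_a2_l1 q)\<inverse>\<inverse>, (T_a1_l1 q)\<inverse>\<inverse>, T_k1_l2 q] \<and>
     aligned (corr_III q sq) [T0 q sq, T1 q sq, T2 q sq, T3 sq]
       [(T_a2_l1 q)\<inverse>\<inverse>, (T_a1_l1 q)\<inverse>\<inverse>, T_k1_l1 q, T_k1_l2 q] \<and>
     aligned (corr_I' q sq) [T0 q sq, T1 q sq, T2 q sq, T3 sq]
       [(T_a1_l1 q)\<inverse>\<inverse>, T_k1_l1 q, (T_a2_l1 q)\<inverse>\<inverse>, (T_k1_l2 q)\<inverse>\<inverse>] \<and>
     aligned (corr_II' q sq) [T0 q sq, T1 q sq, T2 q sq, T3 sq]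
       [T_k1_l1 q, (T_a2_l1 q)\<inverse>\<inverse>, (T_a1_l1 q)\<inverse>\<inverse>, (T_k1_l2 q)\<inverse>\<inverse>] \<and>
     aligned (corr_III' q sq) [T0 q sq, T1 q sq, T2 q sq, T3 sq]
       [(T_a2_l1 q)\<inverse>\<inverse>, (T_a1_l1 q)\<inverse>\<inverse>, T_k1_l1 q, (T_k1_l2 q)\<inverse>\<inverse>] \<and>
     (\<forall>S B. corr_II q sq S B \<longleftrightarrow> corr_I q sq S (sigma0 B)) \<and>
     (\<forall>S b0 b1 b2 f0 f1 f2 b0' b1' b2' f0' f1' f2'.
        corr_II q sq S (Sym b0 b1 b2 f0 f1 f2) \<and> corr_I q sq S (Sym b0' b1' b2' f0' f1' f2') \<longrightarrow>
        b0' ^ 2 = b2 ^ 2 \<and> b1' ^ 2 = b0 ^ 2 \<and>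
        c_squared q (Sym b0' b1' b2' f0' f1' f2') = c_squared q (Sym b0 b1 b2 f0 f1 f2) \<and>
        (b0' = b2 \<longrightarrow> f0' = f2) \<and> (b1' = b0 \<longrightarrow> f1' = f0)) \<and>
     (\<forall>S B. corr_I' q sq S B \<longleftrightarrow> corr_I q sq S (sigma1 B)) \<and>
     (\<forall>S b0 b1 b2 f0 f1 f2 b0' b1' b2' f0' f1' f2'.
        corr_I q sq S (Sym b0 b1 b2 f0 f1 f2) \<and> corr_I' q sq S (Sym b0' b1' b2' f0' f1' f2') \<longrightarrow>
        b0' ^ 2 = b0 ^ 2 \<and> b1' ^ 2 = b1 ^ 2 \<and> b2' ^ 2 = b2 ^ 2 \<and>
        q * c_squared q (Sym b0' b1' b2' f0' f1' f2') =
          1 / (q * c_squared q (Sym b0 b1 b2 f0 f1 f2)) \<and>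
        (b0' = b0 \<longrightarrow> f0' = 1 / f0) \<and> (b1' = b1 \<longrightarrow> f1' = 1 / f1))"
proof -
  note q' = q(1) sq
  note cI = change_of_variables_corr_I[OF q']
  note I = aligned_corr_I[OF q']
  note I' = aligned_sigma1[OF q(1) I corr_I'_iff[OF q']]
  note II = aligned_sigma0[OF I corr_II_iff[OF q']]
  note II' = aligned_sigma1[OF q(1) II corr_II'_iff[OF q']]
  \<comment> \<open>(III) is (II) seen through one more \<open>sigma0\<close>, so its alignment is a
    second rotation of the list.\<close>
  have "corr_III q sq S B \<longleftrightarrow> corr_II q sq S (sigma0 B)" for S B
    using corr_II_iff[OF q'] corr_III_iff[OF q'] by simp
  note III = aligned_sigma0[OF II this]
  note III' = aligned_sigma1[OF q(1) III corr_III'_iff[OF q']]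
  have adm0: "admissible_sym sq (sigma0 B)" if "admissible_sym sq B" for B
    using that by (cases B) auto
  have adm1: "admissible_sym sq (sigma1 B)" if "admissible_sym sq B" for B
    using that admissible_sym_sigma1 by simp
  note cov0 = change_of_variables_transfer[where h = sigma0 and k = "\<lambda>B. sigma0 (sigma0 B)",
      OF _ _ sigma0_cube adm0]
  note cov1 = change_of_variables_transfer[where h = sigma1 and k = sigma1, OF _ _ sigma1_involution adm1]
  have cII: "change_of_variables sq (corr_II q sq)"
    by (rule cov0[OF cI]) (simp_all add: corr_II_iff[OF q'])
  have cIII: "change_of_variables sq (corr_III q sq)"
    by (rule cov0[OF cII]) (simp_all add: corr_II_iff[OF q'] corr_III_iff[OF q'])
  have cI': "change_of_variables sq (corr_I' q sq)"
    by (rule cov1[OF cI]) (simp_all add: corr_I'_iff[OF q'])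
  have cII': "change_of_variables sq (corr_II' q sq)"
    by (rule cov1[OF cII]) (simp_all add: corr_II'_iff[OF q'])
  have cIII': "change_of_variables sq (corr_III' q sq)"
    by (rule cov1[OF cIII]) (simp_all add: corr_III'_iff[OF q'])
  have iff0: "\<forall>S B. corr_II q sq S B \<longleftrightarrow> corr_I q sq S (sigma0 B)"
    and iff1: "\<forall>S B. corr_I' q sq S B \<longleftrightarrow> corr_I q sq S (sigma1 B)"
    using corr_II_iff[OF q'] corr_I'_iff[OF q'] by simp_all
  have e0: "b0' ^ 2 = b2 ^ 2 \<and> b1' ^ 2 = b0 ^ 2 \<and>
      c_squared q (Sym b0' b1' b2' f0' f1' f2') = c_squared q (Sym b0 b1 b2 f0 f1 f2) \<and>
      (b0' = b2 \<longrightarrow> f0' = f2) \<and> (b1' = b0 \<longrightarrow> f1' = f0)"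
    if "corr_II q sq S (Sym b0 b1 b2 f0 f1 f2)" "corr_I q sq S (Sym b0' b1' b2' f0' f1' f2')"
    for S b0 b1 b2 f0 f1 f2 b0' b1' b2' f0' f1' f2'
    using corr_I_f_eq[OF q' that(1)[unfolded corr_II_iff[OF q'] sigma0.simps] that(2)]
    by (simp add: mult_ac)
  have e1: "b0' ^ 2 = b0 ^ 2 \<and> b1' ^ 2 = b1 ^ 2 \<and> b2' ^ 2 = b2 ^ 2 \<and>
      q * c_squared q (Sym b0' b1' b2' f0' f1' f2') = 1 / (q * c_squared q (Sym b0 b1 b2 f0 f1 f2)) \<and>
      (b0' = b0 \<longrightarrow> f0' = 1 / f0) \<and> (b1' = b1 \<longrightarrow> f1' = 1 / f1)"
    if "corr_I q sq S (Sym b0 b1 b2 f0 f1 f2)" "corr_I' q sq S (Sym b0' b1' b2' f0' f1' f2')"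
    for S b0 b1 b2 f0 f1 f2 b0' b1' b2' f0' f1' f2'
  proof -
    \<comment> \<open>The primed point enters (I) through \<open>sigma1\<close>, so the comparison
      equates its reciprocals with the \<open>f\<close>-variables of the other point.\<close>
    note e = corr_I_f_eq[OF q' that(1) that(2)[unfolded corr_I'_iff[OF q'] sigma1.simps]]
    have "f0 * f1 * f2 / q = 1 / (f0' * f1' * f2') / q"
      using e(6) by simp
    then have "f0 * f1 * f2 = 1 / (f0' * f1' * f2')"
      unfolding divide_cancel_right using q(1) by simp
    moreover have "b0' = b0 \<longrightarrow> f0 = 1 / f0'" "b1' = b1 \<longrightarrow> f1 = 1 / f1'"
      "b0' ^ 2 = b0 ^ 2 \<and> b1' ^ 2 = b1 ^ 2 \<and> b2' ^ 2 = b2 ^ 2"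
      using e(1-5) by auto
    ultimately show ?thesis using q(1) by auto
  qed
  have gen: "corresponds (corr_I q sq) (T_a1_l1 q)\<inverse>\<inverse> (T0 q sq)"
    "corresponds (corr_II q sq) (T_k1_l1 q) (T0 q sq)"
    "corresponds (corr_III q sq) (T_a2_l1 q)\<inverse>\<inverse> (T0 q sq)"
    "corresponds (corr_I' q sq) (T_a1_l1 q)\<inverse>\<inverse> (T0 q sq)"
    "corresponds (corr_II' q sq) (T_k1_l1 q) (T0 q sq)"
    "corresponds (corr_III' q sq) (T_a2_l1 q)\<inverse>\<inverse> (T0 q sq)"
    using I II III I' II' III' by (simp_all add: aligned_def)
  show ?thesis
  proof (intro conjI cI cI' cII cII' cIII cIII' gen I I' II II' III III' iff0 iff1, goal_cases)
    case 1
    show ?case by (intro allI impI, elim conjE) (rule e0)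
  next
    case 2
    show ?case by (intro allI impI, elim conjE) (rule e1)
  qed
qed

end
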